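(* For any $\epsilon>0$, there is a randomized algorithm that achieves an approximation guarantee of $1-1/e-\epsilon$ for dynamic monotone submodular maximization under a matroid constraint over insertion-only streams, with amortized query complexity $k^{\tilde{O}(1/\epsilon^2)}\log n$, where $k$ is the rank of the matroid and $n$ the length of the stream.
   Context: A set system $\mathcal{M}\subseteq 2^V$ is a matroid if $\emptyset\in\mathcal{M}$, it is downward closed, and it has the augmentation property (if $S,T\in\mathcal{M}$ with $|S|<|T|$ then $S\cup\{a\}\in\mathcal{M}$ for some $a\in T\setminus S$); its rank $k$ is the maximum size of a set in $\mathcal{M}$. Dynamic submodular maximization under a matroid constraint over insertion-only streams: the algorithm has query access to a nonnegative monotone submodular $f:2^V\to\mathbb{R}$ and to $\mathcal{M}$ (membership queries "is $S\in\mathcal{M}$?"). Starting with $V_0=\emptyset$, in round $i$ an element $e_i$ is inserted, $V_i=V_{i-1}\cup\{e_i\}$, and the algorithm must then output $S_i\subseteq V_i$ with $S_i\in\mathcal{M}$ and $f(S_i)\ge\gamma\cdot\mathrm{OPT}_i$, where $\mathrm{OPT}_i=\max_{T\in\mathcal{M},T\subseteq V_i}f(T)$. A randomized algorithm achieves approximation guarantee $\gamma$ if for every $n$ and every stream of length $n$, with probability at least $2/3$ it does so in every round. Amortized query complexity $Q(n)$ means the total number of queries to $f$ and $\mathcal{M}$ on any stream of length $n$ is at most $n\cdot Q(n)$. *)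

theory Defs
  imports "HOL-Probability.Probability" "HOL-Library.Landau_Symbols"
begin

section \<open>Matroids and monotone submodular functions\<close>

definition matroid :: "'a set \<Rightarrow> 'a set set \<Rightarrow> bool" where
  "matroid V M \<longleftrightarrow>
     finite V \<and> M \<subseteq> Pow V \<and> {} \<in> M \<and>
     (\<forall>T\<in>M. \<forall>S. S \<subseteq> T \<longrightarrow> S \<in> M) \<and>
     (\<forall>S\<in>M. \<forall>T\<in>M. card S < card T \<longrightarrow> (\<exists>a\<in>T - S. insert a S \<in> M))"

definition matroid_rank :: "'a set set \<Rightarrow> nat" where
  "matroid_rank M = Max (card ` M)"

text \<open>Set functions are total in HOL; only their values on subsets of the ground set \<open>V\<close> are
  constrained.\<close>

definition nonneg_monotone_submodular :: "'a set \<Rightarrow> ('a set \<Rightarrow> real) \<Rightarrow> bool" where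
  "nonneg_monotone_submodular V f \<longleftrightarrow>
     (\<forall>S. S \<subseteq> V \<longrightarrow> 0 \<le> f S) \<and>
     (\<forall>S T. S \<subseteq> T \<longrightarrow> T \<subseteq> V \<longrightarrow> f S \<le> f T) \<and>
     (\<forall>S T. S \<subseteq> V \<longrightarrow> T \<subseteq> V \<longrightarrow> f (S \<union> T) + f (S \<inter> T) \<le> f S + f T)"

definition opt :: "('a set \<Rightarrow> real) \<Rightarrow> 'a set set \<Rightarrow> 'a set \<Rightarrow> real" where
  "opt f M W = Max (f ` {T \<in> M. T \<subseteq> W})"

section \<open>Randomized online algorithms with oracle access\<close>

text \<open>A \<open>prog\<close> is one round of computation: an adaptive decision tree whose inner nodes ask for
  the value of \<open>f\<close> on a set, ask whether a set is in \<open>M\<close>, or draw fresh randomness, and whose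
  leaves carry the result. Being a datatype, it terminates on every branch.  Only queries are
  counted; other computation is free.\<close>

datatype ('a, 'r) prog =
    Return 'r
  | Query_Value "'a set" "real \<Rightarrow> ('a, 'r) prog"
  | Query_Member "'a set" "bool \<Rightarrow> ('a, 'r) prog"
  | Draw "nat pmf" "nat \<Rightarrow> ('a, 'r) prog"

text \<open>An algorithm reacts to each inserted element with a program returning the output set of
  that round and the algorithm that will process the rest of the stream; the latter plays the
  role of the internal memory (of arbitrary size).  The algorithm receives no other input; in
  particular it is told neither the ground set, nor the length of the stream, nor the rank.\<close>

codatatype 'a algorithm =
  Algorithm (react: "'a \<Rightarrow> ('a, 'a set \<times> 'a algorithm) prog")

text \<open>Joint distribution of the result and the list of queried sets.\<close>

primrec exec :: "('a set \<Rightarrow> real) \<Rightarrow> 'a set set \<Rightarrow> ('a, 'r) prog \<Rightarrow> ('r \<times> 'a set list) pmf" where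
  "exec f M (Return r) = return_pmf (r, [])"
| "exec f M (Query_Value S c) = map_pmf (\<lambda>(r, qs). (r, S # qs)) (exec f M (c (f S)))"
| "exec f M (Query_Member S c) = map_pmf (\<lambda>(r, qs). (r, S # qs)) (exec f M (c (S \<in> M)))"
| "exec f M (Draw p c) = bind_pmf p (\<lambda>x. exec f M (c x))"

text \<open>Distribution of the protocol of a whole stream: for each round, the output set and the
  list of queried sets.\<close>

fun run :: "('a set \<Rightarrow> real) \<Rightarrow> 'a set set \<Rightarrow> 'a algorithm \<Rightarrow> 'a list \<Rightarrow> ('a set \<times> 'a set list) list pmf"
where
  "run f M A [] = return_pmf []"
| "run f M A (e # es) =
     bind_pmf (exec f M (react A e))
       (\<lambda>((S, A'), qs). map_pmf (\<lambda>rs. (S, qs) # rs) (run f M A' es))"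

section \<open>Performance of an algorithm\<close>

text \<open>\<open>V\<^sub>i\<close> for the (0-based) round \<open>i\<close>, after the insertion in that round.\<close>

definition inserted :: "'a list \<Rightarrow> nat \<Rightarrow> 'a set" where
  "inserted es i = set (take (Suc i) es)"

definition admissible :: "'a set \<Rightarrow> 'a set set \<Rightarrow> ('a set \<Rightarrow> real) \<Rightarrow> 'a list \<Rightarrow> bool" where
  "admissible V M f es \<longleftrightarrow> matroid V M \<and> nonneg_monotone_submodular V f \<and> set es \<subseteq> V"

definition good_round ::
  "real \<Rightarrow> ('a set \<Rightarrow> real) \<Rightarrow> 'a set set \<Rightarrow> 'a set \<Rightarrow> 'a set \<Rightarrow> bool" where
  "good_round \<gamma> f M W S \<longleftrightarrow> S \<subseteq> W \<and> S \<in> M \<and> f S \<ge> \<gamma> * opt f M W"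

definition approximation_guarantee :: "'a algorithm \<Rightarrow> real \<Rightarrow> bool" where
  "approximation_guarantee A \<gamma> \<longleftrightarrow>
     (\<forall>V M f es. admissible V M f es \<longrightarrow>
        measure_pmf.prob (run f M A es)
          {rs. \<forall>i<length es. good_round \<gamma> f M (inserted es i) (fst (rs ! i))} \<ge> 2 / 3)"

text \<open>Elements that have not arrived yet are unknown to the algorithm and may not occur in its
  queries.\<close>

definition queries_only_inserted :: "'a algorithm \<Rightarrow> bool" where
  "queries_only_inserted A \<longleftrightarrow>
     (\<forall>V M f es. admissible V M f es \<longrightarrow>
        (\<forall>rs\<in>set_pmf (run f M A es). \<forall>i<length es. \<forall>Q\<in>set (snd (rs ! i)). Q \<subseteq> inserted es i))"

definition total_queries :: "('a set \<times> 'a set list) list \<Rightarrow> nat" where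
  "total_queries rs = (\<Sum>(S, qs)\<leftarrow>rs. length qs)"

text \<open>The bound \<open>Q k n\<close> depends on the rank \<open>k\<close> and the stream length \<open>n\<close>, and holds for every
  outcome of the random draws.\<close>

definition amortized_query_complexity :: "'a algorithm \<Rightarrow> (nat \<Rightarrow> nat \<Rightarrow> real) \<Rightarrow> bool" where
  "amortized_query_complexity A Q \<longleftrightarrow>
     (\<forall>V M f es. admissible V M f es \<longrightarrow>
        (\<forall>rs\<in>set_pmf (run f M A es).
           real (total_queries rs) \<le> real (length es) * Q (matroid_rank M) (length es)))"

text \<open>\<open>f \<in> soft_bigo F g\<close>, i.e. \<open>f = O(g log\<^sup>c g)\<close> for some constant \<open>c\<close>.\<close>

definition soft_bigo :: "'b filter \<Rightarrow> ('b \<Rightarrow> real) \<Rightarrow> ('b \<Rightarrow> real) set" where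
  "soft_bigo F g = (\<Union>c::nat. O[F](\<lambda>x. g x * ln (g x) ^ c))"

end

(* The algorithm is deterministic. It maintains a solution X coloured with l = O(1/eps) colours that
   is locally optimal, under exchanges of one element, for the non-oblivious potential of Buchbinder
   and Feldman: a weighted sum of f over the unions of colour classes. Such an optimum is a
   (1 - (1 + 1/l)^-l)-approximation, and evaluating the potential takes only 2^l queries.

   An exchange is made only if it increases the potential by a factor 1 + 1/(l^2 k), and only
   elements whose value is at least a 1/(l k) fraction of the largest singleton value are considered;
   the others are worth at most OPT/l together. As the potential is within a factor poly(k, l) of the
   largest singleton value, each element is scanned poly(k, l) times before it becomes negligible,
   whatever the length of the stream. *)

theory Submission
  imports Defs
begin

text \<open>Exchange-based local search on \<open>f\<close> itself guarantees only 1/2, hence the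
  potential. To colour an element is to choose one of \<open>l\<close> parallel copies of it, so a
  coloured solution is an independent set of a larger matroid, and the ordinary exchange argument
  applies there. The ratio loses 1/l three times: for the distance of (1 + 1/l)^-l from 1/e, for the
  neglected elements, and for the improvements too small to be made. This gives l = 3/\<epsilon>,
  rounded up. The obstacle to the query bound is that the rank is not known in advance. When the
  rank of the inserted elements grows, the improvement threshold and the set of elements to be
  considered change, and a new scan is due. Queries are therefore paid from a credit: an element
  pays for one scan per future growth of the rank and for one per future improvement while it is
  still considered. The latter number is bounded on arrival only if the potential is never small
  against a singleton value; restarting from a new element that alone would more than double the
  potential ensures this.\<close>

section \<open>Exchange in matroids\<close>

lemma matroidD:
  assumes "matroid V M"
  shows "finite V" "{} \<in> M" "\<And>S. S \<in> M \<Longrightarrow> S \<subseteq> V"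
    "\<And>S T. T \<in> M \<Longrightarrow> S \<subseteq> T \<Longrightarrow> S \<in> M"
    "\<And>S. S \<in> M \<Longrightarrow> finite S"
    "\<And>S T. S \<in> M \<Longrightarrow> T \<in> M \<Longrightarrow> card S < card T \<Longrightarrow> \<exists>a\<in>T - S. insert a S \<in> M"
proof -
  show 1: "finite V" and "{} \<in> M" and 2: "\<And>S. S \<in> M \<Longrightarrow> S \<subseteq> V"
    using assms unfolding matroid_def by auto
  show "\<And>S. S \<in> M \<Longrightarrow> finite S" using 1 2 finite_subset by metis
  show "\<And>S T. T \<in> M \<Longrightarrow> S \<subseteq> T \<Longrightarrow> S \<in> M"
    "\<And>S T. S \<in> M \<Longrightarrow> T \<in> M \<Longrightarrow> card S < card T \<Longrightarrow> \<exists>a\<in>T - S. insert a S \<in> M"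
    using assms unfolding matroid_def by simp_all
qed

lemma matroid_extend:
  assumes "matroid V M" "A \<in> M" "B \<in> M" "card A \<le> card B"
  shows "\<exists>C\<in>M. A \<subseteq> C \<and> C \<subseteq> A \<union> B \<and> card C = card B"
  using assms(2,4)
proof (induction "card B - card A" arbitrary: A)
  case 0
  then show ?case by (intro bexI[of _ A]) auto
next
  case (Suc n)
  from Suc.hyps(2) have "card A < card B" by simp
  then obtain a where a: "a \<in> B - A" "insert a A \<in> M"
    using matroidD(6)[OF assms(1) Suc.prems(1) assms(3)] by blast
  have c: "card (insert a A) = Suc (card A)"
    using a matroidD(5)[OF assms(1) Suc.prems(1)] by simp
  have "\<exists>C\<in>M. insert a A \<subseteq> C \<and> C \<subseteq> insert a A \<union> B \<and> card C = card B"
    by (rule Suc.hyps(1)) (use Suc.hyps(2) a c \<open>card A < card B\<close> in simp_all)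
  then obtain C where "C \<in> M" "insert a A \<subseteq> C" "C \<subseteq> insert a A \<union> B" "card C = card B" by blast
  then show ?case using a(1) by (intro bexI[of _ C]) auto
qed

text \<open>Candidates for \<open>x\<close> are the elements whose removal from \<open>I\<close>
  makes room for \<open>y\<close>. If they all lay in the span of \<open>J - {y}\<close>, so would
  \<open>y\<close>, against the independence of \<open>J\<close>. If \<open>y\<close> can be added
  to \<open>I\<close> outright, counting suffices.\<close>

lemma symmetric_exchange:
  assumes m: "matroid V M" and I: "I \<in> M" and J: "J \<in> M" and c: "card I = card J"
    and y: "y \<in> J - I"
  shows "\<exists>x\<in>I - J. insert y (I - {x}) \<in> M \<and> insert x (J - {y}) \<in> M"
proof -
  note fin = matroidD(5)[OF m] and down = matroidD(4)[OF m] and aug = matroidD(6)[OF m]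
  have Jy: "J - {y} \<in> M" "card (J - {y}) < card J"
    using down[OF J, of "J - {y}"] y card_Diff1_less[OF fin[OF J], of y] by auto
  \<comment> \<open>If \<open>insert y I\<close> is dependent, this is the fundamental circuit of
    \<open>y\<close> in \<open>I\<close>, without \<open>y\<close>.\<close>
  define D where "D = {x \<in> I. insert y (I - {x}) \<in> M}"
  have DM: "D \<in> M" using down[OF I] by (auto simp: D_def)
  have "\<exists>x\<in>D - (J - {y}). insert x (J - {y}) \<in> M"
  proof (cases "insert y I \<in> M")
    case True
    have "insert y (I - {x}) \<in> M" for x by (rule down[OF True]) auto
    then have "D = I" by (auto simp: D_def)
    then show ?thesis using aug[OF Jy(1) I] Jy(2) c by simp
  next
    case False
    \<comment> \<open>Otherwise \<open>insert y D\<close> extends within \<open>I\<close> to a set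
      \<open>K\<close> as large as \<open>I\<close>. It misses some \<open>x\<close> of
      \<open>I\<close>, hence is \<open>I\<close> with \<open>x\<close> replaced by
      \<open>y\<close>, and so \<open>x\<close> belongs to \<open>D\<close> after all.\<close>
    have Dy: "insert y D \<notin> M"
    proof
      assume a: "insert y D \<in> M"
      have "D \<subset> I" using a False by (auto simp: D_def)
      then have "card (insert y D) \<le> card I"
        using y fin[OF I] psubset_card_mono[of I D] finite_subset[of D I] by (auto simp: card_insert_if)
      from matroid_extend[OF m a I this] obtain K where K: "K \<in> M" "insert y D \<subseteq> K"
        "K \<subseteq> insert y D \<union> I" "card K = card I" by blast
      have "\<not> I \<subseteq> K"
      proof
        assume "I \<subseteq> K"
        then have "I = K" using card_subset_eq[OF fin[OF K(1)]] K(4) by metis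
        then show False using K(2) y by auto
      qed
      then obtain x where x: "x \<in> I" "x \<notin> K" by blast
      have "K \<subseteq> insert y (I - {x})" using K x by (auto simp: D_def)
      moreover have "card (insert y (I - {x})) = card K"
        using y x fin[OF I] K(4) card_Suc_Diff1[of I x] by (simp add: card_insert_if)
      ultimately have "K = insert y (I - {x})"
        using card_subset_eq[of "insert y (I - {x})" K] fin[OF I] by auto
      then have "x \<in> D" using x K(1) by (auto simp: D_def)
      then show False using K(2) x by auto
    qed
    show ?thesis
    proof (rule ccontr)
      \<comment> \<open>\<open>D\<close> extends to a set \<open>D'\<close> of the size of
        \<open>J - {y}\<close>, which \<open>J\<close> augments by some \<open>a\<close> other than
        \<open>y\<close>. The result is larger than \<open>J - {y}\<close> and augments it,
        necessarily by an element of \<open>D\<close>.\<close>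
      assume neg: "\<not> ?thesis"
      then have "card D \<le> card (J - {y})" using aug[OF Jy(1) DM] by force
      from matroid_extend[OF m DM Jy(1) this] obtain D' where D': "D' \<in> M" "D \<subseteq> D'"
        "D' \<subseteq> D \<union> (J - {y})" "card D' = card (J - {y})" by blast
      obtain a where a: "a \<in> J - D'" "insert a D' \<in> M" using aug[OF D'(1) J] D'(4) Jy(2) by auto
      have "a \<noteq> y" using down[OF a(2), of "insert y D"] Dy D'(2) by auto
      have "card (J - {y}) < card (insert a D')" using a fin[OF D'(1)] D'(4) by simp
      from aug[OF Jy(1) a(2) this] obtain z where "z \<in> insert a D' - (J - {y})"
        "insert z (J - {y}) \<in> M" by blast
      then show False using neg D'(3) a(1) \<open>a \<noteq> y\<close> by blast
    qed
  qed
  then show ?thesis using y by (auto simp: D_def)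
qed

text \<open>Induction on the distance of \<open>J\<close> from \<open>I\<close>: a symmetric
  exchange replaces \<open>y\<close> by \<open>x\<close> in \<open>J\<close>, keeping its size and
  bringing it closer to \<open>I\<close>. As \<open>x\<close> then lies in both sets, the remaining
  pairs cannot use it again, and \<open>h\<close> stays injective.\<close>

lemma exchange_bijection:
  assumes m: "matroid V M" and I: "I \<in> M" and J: "J \<in> M" and c: "card I = card J"
  shows "\<exists>h. inj_on h (J - I) \<and> h ` (J - I) \<subseteq> I - J \<and> (\<forall>y\<in>J - I. insert y (I - {h y}) \<in> M)"
  using J c
proof (induction "card (J - I)" arbitrary: J)
  case 0
  then have e: "J - I = {}" using matroidD(5)[OF m 0(2)] by simp
  show ?case unfolding e by simp
next
  case (Suc n)
  note fin = matroidD(5)[OF m]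
  from Suc.hyps(2) have "J - I \<noteq> {}" by (metis card.empty nat.distinct(1))
  then obtain y where y: "y \<in> J - I" by blast
  from symmetric_exchange[OF m I Suc.prems y] obtain x where x: "x \<in> I - J"
    "insert y (I - {x}) \<in> M" "insert x (J - {y}) \<in> M" by blast
  let ?J = "insert x (J - {y})"
  have d: "?J - I = (J - I) - {y}" "I - ?J = (I - J) - {x}" using x y by auto
  have "n = card (?J - I)" unfolding d using Suc.hyps(2) y fin[OF Suc.prems(1)] by simp
  moreover have "card I = card ?J"
    using x y fin[OF Suc.prems(1)] Suc.prems(2) card_Suc_Diff1[of J y] by (simp add: card_insert_if)
  ultimately obtain h where h: "inj_on h ((J - I) - {y})" "h ` ((J - I) - {y}) \<subseteq> (I - J) - {x}"
    "\<forall>z\<in>(J - I) - {y}. insert z (I - {h z}) \<in> M"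
    using Suc.hyps(1)[OF _ x(3)] unfolding d by blast
  have "inj_on (h(y := x)) ((J - I) - {y})" using h(1) by (rule inj_on_fun_updI) (use h(2) in blast)
  moreover have "(h(y := x)) ` ((J - I) - {y}) \<subseteq> (I - J) - {x}" using h(2) by simp
  ultimately have "inj_on (h(y := x)) (insert y ((J - I) - {y}))" by (subst inj_on_insert) auto
  moreover have "insert y ((J - I) - {y}) = J - I" using y by blast
  ultimately have 1: "inj_on (h(y := x)) (J - I)" by simp
  have 2: "(h(y := x)) z \<in> I - J \<and> insert z (I - {(h(y := x)) z}) \<in> M" if "z \<in> J - I" for z
    using h(2,3) x that by (cases "z = y") auto
  show ?case using 1 2 by (intro exI[of _ "h(y := x)"]) blast
qed

text \<open>The smaller set is extended within the union to the size of the larger one, so that the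
  bijection applies. If \<open>B\<close> is the smaller, the elements of \<open>A\<close> used to
  extend it can be added to \<open>B\<close> without a removal; they are the ones left out of
  \<open>S\<close>.\<close>

lemma exchange_partial_injection:
  assumes m: "matroid V M" and B: "B \<in> M" and A: "A \<in> M"
  shows "\<exists>S h. S \<subseteq> A - B \<and> inj_on h S \<and> h ` S \<subseteq> B \<and> (\<forall>y\<in>S. insert y (B - {h y}) \<in> M) \<and>
           (\<forall>y\<in>A - B - S. insert y B \<in> M)"
proof (cases "card A \<le> card B")
  case True
  from matroid_extend[OF m A B True] obtain C where C: "C \<in> M" "A \<subseteq> C" "C \<subseteq> A \<union> B" "card C = card B"
    by blast
  from exchange_bijection[OF m B C(1) C(4)[symmetric]] obtain h where
    h: "inj_on h (C - B)" "h ` (C - B) \<subseteq> B - C" "\<forall>y\<in>C - B. insert y (B - {h y}) \<in> M" by blast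
  show ?thesis
    using h C(2) by (intro exI[of _ "A - B"] exI[of _ h]) (auto intro: inj_on_subset)
next
  case False
  then have "card B \<le> card A" by simp
  from matroid_extend[OF m B A this] obtain C where C: "C \<in> M" "B \<subseteq> C" "C \<subseteq> B \<union> A" "card C = card A"
    by blast
  from exchange_bijection[OF m C(1) A C(4)] obtain h where
    h: "inj_on h (A - C)" "h ` (A - C) \<subseteq> C - A" "\<forall>y\<in>A - C. insert y (C - {h y}) \<in> M" by blast
  have "insert y (B - {h y}) \<in> M" if "y \<in> A - C" for y
    by (rule matroidD(4)[OF m h(3)[rule_format, OF that]]) (use C in auto)
  moreover have "insert y B \<in> M" if "y \<in> A - B - (A - C)" for y
    by (rule matroidD(4)[OF m C(1)]) (use C that in auto)
  ultimately show ?thesis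
    using h C by (intro exI[of _ "A - C"] exI[of _ h]) blast
qed

section \<open>Submodular functions\<close>

lemma nmsD:
  assumes "nonneg_monotone_submodular V f"
  shows "\<And>S. S \<subseteq> V \<Longrightarrow> 0 \<le> f S" "\<And>S T. S \<subseteq> T \<Longrightarrow> T \<subseteq> V \<Longrightarrow> f S \<le> f T"
    "\<And>S T. S \<subseteq> V \<Longrightarrow> T \<subseteq> V \<Longrightarrow> f (S \<union> T) + f (S \<inter> T) \<le> f S + f T"
  using assms unfolding nonneg_monotone_submodular_def by auto

lemma diminishing_returns:
  assumes "nonneg_monotone_submodular V g" "A \<subseteq> B" "B \<subseteq> V" "x \<in> V"
  shows "g (insert x B) - g B \<le> g (insert x A) - g A"
proof (cases "x \<in> B")
  case True
  then show ?thesis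
    using nmsD(2)[OF assms(1), of A "insert x A"] assms by (auto simp: insert_absorb)
next
  case False
  then have "insert x A \<union> B = insert x B" "insert x A \<inter> B = A" using assms by auto
  moreover have "insert x A \<subseteq> V" using assms by auto
  ultimately show ?thesis
    using nmsD(3)[OF assms(1) _ assms(3), of "insert x A"] by simp
qed

lemma gain_le_sum_gains:
  assumes g: "nonneg_monotone_submodular V g" and "finite A" "A \<subseteq> V" and X: "X \<subseteq> V"
  shows "g (X \<union> A) - g X \<le> (\<Sum>a\<in>A. g (insert a X) - g X)"
  using assms(2,3)
proof (induction A rule: finite_induct)
  case (insert a A)
  have "g (insert a (X \<union> A)) - g (X \<union> A) \<le> g (insert a X) - g X"
    by (rule diminishing_returns[OF g]) (use insert.prems X in auto)
  then show ?case using insert by simp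
qed simp

lemma sum_losses_le_loss:
  assumes g: "nonneg_monotone_submodular V g" and "finite A" and "A \<subseteq> X" and X: "X \<subseteq> V"
  shows "(\<Sum>b\<in>A. g X - g (X - {b})) \<le> g X - g (X - A)"
  using assms(2,3)
proof (induction A rule: finite_induct)
  case (insert a A)
  have "g (insert a (X - {a})) - g (X - {a}) \<le> g (insert a (X - insert a A)) - g (X - insert a A)"
    by (rule diminishing_returns[OF g]) (use insert.prems X in auto)
  moreover have "insert a (X - {a}) = X" "insert a (X - insert a A) = X - A" 
    using insert by auto
  ultimately show ?case using insert by simp
qed simp

text \<open>Local optimality is summed over the exchange pairs. By diminishing returns, swapping
  \<open>h y\<close> for \<open>y\<close> gains at least the gain of adding \<open>y\<close> minus
  the loss of removing \<open>h y\<close>; as \<open>h\<close> is injective, each loss is counted at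
  most once.\<close>

lemma local_optimum_gain:
  assumes m: "matroid V M" and g: "nonneg_monotone_submodular V g" and X: "X \<in> M" and A: "A \<in> M"
    and loc: "\<And>a Y. a \<in> A - X \<Longrightarrow> Y \<subseteq> X \<Longrightarrow> card Y \<le> 1 \<Longrightarrow> insert a (X - Y) \<in> M \<Longrightarrow>
           g (insert a (X - Y)) \<le> g X + \<eta>"
    and \<eta>: "0 \<le> \<eta>"
  shows "g (X \<union> A) - g X \<le> (\<Sum>b\<in>X. g X - g (X - {b})) + real (card A) * \<eta>"
proof -
  from exchange_partial_injection[OF m X A] obtain S h where
    S: "S \<subseteq> A - X" "inj_on h S" "h ` S \<subseteq> X" "\<forall>y\<in>S. insert y (X - {h y}) \<in> M"
      "\<forall>y\<in>A - X - S. insert y X \<in> M" by blast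
  note fin = matroidD(5)[OF m] and XV = matroidD(3)[OF m X] and AV = matroidD(3)[OF m A]
  have SA: "S \<subseteq> A" using S(1) by blast
  have gS: "g (insert y X) - g X \<le> (g X - g (X - {h y})) + \<eta>" if "y \<in> S" for y
  proof -
    have "g (insert y X) - g X \<le> g (insert y (X - {h y})) - g (X - {h y})"
      by (rule diminishing_returns[OF g]) (use that S XV AV in auto)
    moreover have "g (insert y (X - {h y})) \<le> g X + \<eta>"
      by (rule loc) (use that S in auto)
    ultimately show ?thesis by simp
  qed
  have gN: "g (insert y X) - g X \<le> \<eta>" if "y \<in> A - S" for y
  proof (cases "y \<in> X")
    case True
    then show ?thesis using \<eta> by (simp add: insert_absorb)
  next
    case False
    then have "g (insert y (X - {})) \<le> g X + \<eta>"
      by (intro loc) (use that S in auto)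
    then show ?thesis by simp
  qed
  have "g (X \<union> A) - g X \<le> (\<Sum>a\<in>A. g (insert a X) - g X)"
    by (rule gain_le_sum_gains[OF g fin[OF A] AV XV])
  also have "\<dots> = (\<Sum>a\<in>S. g (insert a X) - g X) + (\<Sum>a\<in>A - S. g (insert a X) - g X)"
    by (subst sum.subset_diff[OF SA fin[OF A]]) simp
  also have "\<dots> \<le> (\<Sum>a\<in>S. (g X - g (X - {h a})) + \<eta>) + (\<Sum>a\<in>A - S. \<eta>)"
    by (intro add_mono sum_mono gS gN)
  also have "\<dots> = (\<Sum>a\<in>S. g X - g (X - {h a})) + real (card A) * \<eta>"
    using sum.subset_diff[OF SA fin[OF A], of "\<lambda>_. \<eta>"] by (simp add: sum.distrib)
  also have "(\<Sum>a\<in>S. g X - g (X - {h a})) = (\<Sum>b\<in>h ` S. g X - g (X - {b}))"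
    using S(2) by (simp add: sum.reindex)
  also have "\<dots> \<le> (\<Sum>b\<in>X. g X - g (X - {b}))"
    using S(3) fin[OF X] nmsD(2)[OF g] XV by (intro sum_mono2) auto
  finally show ?thesis by simp
qed

section \<open>The potential of a coloured set\<close>

definition color_proj :: "nat set \<Rightarrow> ('a \<times> nat) set \<Rightarrow> 'a set" where
  "color_proj J X = fst ` {p \<in> X. snd p \<in> J}"

text \<open>\<open>M\<close> with every element replaced by \<open>l\<close> parallel copies, one
  per colour.\<close>

definition lift_matroid :: "nat \<Rightarrow> 'a set set \<Rightarrow> ('a \<times> nat) set set" where
  "lift_matroid l M = {X. X \<subseteq> UNIV \<times> {..<l} \<and> inj_on fst X \<and> fst ` X \<in> M}"

text \<open>For \<open>i > 0\<close> this is (1 + 1/l)^(i-1) divided by the binomial coefficient of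
  l-1 over i-1. The value 0 removes the empty union from the potential; the union of all colours has
  weight (1 + 1/l)^(l-1).\<close>

definition weight :: "nat \<Rightarrow> nat \<Rightarrow> real" where
  "weight l i = (if i = 0 then 0
     else (1 + 1 / real l) ^ (i - 1) * fact (i - 1) * fact (l - i) / fact (l - 1))"

definition potential :: "nat \<Rightarrow> ('a set \<Rightarrow> real) \<Rightarrow> ('a \<times> nat) set \<Rightarrow> real" where
  "potential l f X = (\<Sum>J\<in>Pow {..<l}. weight l (card J) * f (color_proj J X))"

lemma color_proj_subset: "X \<subseteq> V \<times> B \<Longrightarrow> color_proj J X \<subseteq> V"
  by (auto simp: color_proj_def)

lemma color_proj_subset_image: "color_proj J X \<subseteq> fst ` X"
  by (auto simp: color_proj_def)

lemma color_proj_all: "X \<subseteq> UNIV \<times> J \<Longrightarrow> color_proj J X = fst ` X"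
  by (force simp: color_proj_def)

lemma color_proj_Un: "color_proj J (X \<union> Y) = color_proj J X \<union> color_proj J Y"
  by (auto simp: color_proj_def)

lemma color_proj_mono: "X \<subseteq> Y \<Longrightarrow> color_proj J X \<subseteq> color_proj J Y"
  by (auto simp: color_proj_def)

section \<open>The lifted matroid and submodularity of the potential\<close>

lemma matroid_lift:
  assumes "matroid V M"
  shows "matroid (V \<times> {..<l}) (lift_matroid l M)"
  unfolding matroid_def
proof (intro conjI ballI allI impI)
  note D = matroidD[OF assms]
  show "finite (V \<times> {..<l})" using D(1) by simp
  show "lift_matroid l M \<subseteq> Pow (V \<times> {..<l})"
    using D(3) by (fastforce simp: lift_matroid_def)
  show "{} \<in> lift_matroid l M" using D(2) by (simp add: lift_matroid_def)
  show "S \<in> lift_matroid l M" if "T \<in> lift_matroid l M" "S \<subseteq> T" for S T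
    using that D(4)[of "fst ` T" "fst ` S"] inj_on_subset[of fst T S]
    by (auto simp: lift_matroid_def image_mono)
  show "\<exists>a\<in>T - S. insert a S \<in> lift_matroid l M"
    if S: "S \<in> lift_matroid l M" and T: "T \<in> lift_matroid l M" and c: "card S < card T" for S T
  proof -
    have "card (fst ` S) < card (fst ` T)"
      using S T c by (simp add: lift_matroid_def card_image)
    then obtain x where x: "x \<in> fst ` T - fst ` S" "insert x (fst ` S) \<in> M"
      using D(6)[of "fst ` S" "fst ` T"] S T by (auto simp: lift_matroid_def)
    then obtain p where p: "p \<in> T" "fst p = x" by blast
    have "insert p S \<in> lift_matroid l M"
      using S T p x by (auto simp: lift_matroid_def)
    then show ?thesis using p x by blast
  qed
qed

lemma lift_matroid_subset: "matroid V M \<Longrightarrow> X \<in> lift_matroid l M \<Longrightarrow> X \<subseteq> V \<times> {..<l}"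
  using matroidD(3)[OF matroid_lift] .

lemma lift_matroid_finite: "matroid V M \<Longrightarrow> X \<in> lift_matroid l M \<Longrightarrow> finite X"
  using matroidD(5)[OF matroid_lift] .

text \<open>Projection commutes with unions but not with intersections, since \<open>S\<close> and
  \<open>T\<close> may contain the same element in different colours. Monotonicity of
  \<open>f\<close> makes up for this.\<close>

lemma nms_color_proj:
  assumes f: "nonneg_monotone_submodular V f"
  shows "nonneg_monotone_submodular (V \<times> B) (\<lambda>X. f (color_proj J X))"
  unfolding nonneg_monotone_submodular_def
proof (intro conjI allI impI)
  note D = nmsD[OF f]
  show "0 \<le> f (color_proj J S)" if "S \<subseteq> V \<times> B" for S
    by (rule D(1)[OF color_proj_subset[OF that]])
  show "f (color_proj J S) \<le> f (color_proj J T)" if "S \<subseteq> T" "T \<subseteq> V \<times> B" for S T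
    by (rule D(2)[OF color_proj_mono[OF that(1)] color_proj_subset[OF that(2)]])
  show "f (color_proj J (S \<union> T)) + f (color_proj J (S \<inter> T)) \<le> f (color_proj J S) + f (color_proj J T)"
    if "S \<subseteq> V \<times> B" "T \<subseteq> V \<times> B" for S T
  proof -
    have s: "color_proj J S \<subseteq> V" "color_proj J T \<subseteq> V" using that color_proj_subset by metis+
    have "f (color_proj J (S \<inter> T)) \<le> f (color_proj J S \<inter> color_proj J T)"
      by (rule D(2)) (use s in \<open>auto simp: color_proj_def\<close>)
    with D(3)[OF s] show ?thesis by (simp add: color_proj_Un)
  qed
qed

section \<open>Weights and the telescoping identity\<close>

lemma weight_nonneg: "0 \<le> weight l i"
  by (simp add: weight_def)

lemma nms_potential:
  assumes "nonneg_monotone_submodular V f"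
  shows "nonneg_monotone_submodular (V \<times> B) (potential l f)"
proof -
  note D = nmsD[OF nms_color_proj[OF assms, of B]]
  show ?thesis
    unfolding nonneg_monotone_submodular_def potential_def sum.distrib[symmetric] distrib_left[symmetric]
    by (intro conjI allI impI sum_nonneg sum_mono mult_nonneg_nonneg mult_left_mono weight_nonneg D)
qed

lemma weight_step:
  assumes "0 < i" "i < l"
  shows "(real l + 1) * real i * weight l i = real l * (real l - real i) * weight l (Suc i)"
proof -
  obtain i' where i: "i = Suc i'" using assms(1) by (cases i) auto
  obtain d where d: "l = Suc (i + d)" using assms(2) less_iff_Suc_add by auto
  have 1: "real l - real i = real (Suc d)" by (simp add: d)
  have 2: "l - i = Suc d" "l - Suc i = d" by (simp_all add: d)
  have 3: "(1 + 1 / real l) * real l = real l + 1" by (simp add: d field_simps)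
  have "real l * (real l - real i) * weight l (Suc i) =
     ((1 + 1 / real l) * real l) * real i * ((1 + 1 / real l) ^ i' * fact i' * (real (Suc d) * fact d) / fact (l - 1))"
    unfolding 1 weight_def 2 by (simp add: i mult_ac)
  also have "\<dots> = (real l + 1) * real i * weight l i"
    unfolding 3 weight_def 2 by (simp add: i)
  finally show ?thesis by simp
qed

text \<open>Double counting of the pairs of a set and one of its members, regrouped by what remains
  when the member is removed: a set \<open>J\<close> remains once for each element of
  \<open>A\<close> outside it.\<close>

lemma sum_Pow_remove:
  fixes w :: "nat \<Rightarrow> real"
  assumes A: "finite A"
  shows "(\<Sum>J\<in>Pow A. w (card J) * (\<Sum>j\<in>J. \<phi> (J - {j}))) =
     (\<Sum>J\<in>Pow A. (real (card A) - real (card J)) * w (Suc (card J)) * \<phi> J)"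
proof -
  have fin: "J \<in> Pow A \<Longrightarrow> finite J" for J using A finite_subset by auto
  have "(\<Sum>J\<in>Pow A. w (card J) * (\<Sum>j\<in>J. \<phi> (J - {j}))) =
      (\<Sum>(J, j)\<in>Sigma (Pow A) (\<lambda>J. J). w (card J) * \<phi> (J - {j}))"
    using A fin by (subst sum.Sigma[symmetric]) (auto simp: sum_distrib_left)
  also have "\<dots> = (\<Sum>(J, j)\<in>Sigma (Pow A) (\<lambda>J. A - J). w (Suc (card J)) * \<phi> J)"
  proof (rule sum.reindex_bij_witness[where i = "\<lambda>(J, j). (insert j J, j)" and j = "\<lambda>(J, j). (J - {j}, j)"])
    fix p assume "p \<in> Sigma (Pow A) (\<lambda>J. J)"
    then obtain J j where p: "p = (J, j)" "J \<subseteq> A" "j \<in> J" by auto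
    have "Suc (card (J - {j})) = card J"
      using p fin[of J] by (intro card_Suc_Diff1) auto
    then show "(case case p of (J, j) \<Rightarrow> (J - {j}, j) of (J, j) \<Rightarrow> w (Suc (card J)) * \<phi> J) =
         (case p of (J, j) \<Rightarrow> w (card J) * \<phi> (J - {j}))"
      using p by simp
  qed auto
  also have "\<dots> = (\<Sum>J\<in>Pow A. \<Sum>j\<in>A - J. w (Suc (card J)) * \<phi> J)"
    using A fin by (subst sum.Sigma[symmetric]) auto
  also have "\<dots> = (\<Sum>J\<in>Pow A. (real (card A) - real (card J)) * w (Suc (card J)) * \<phi> J)"
  proof (rule sum.cong)
    fix J assume "J \<in> Pow A"
    then have "J \<subseteq> A" "finite J" using fin by auto
    then have "real (card (A - J)) = real (card A) - real (card J)"
      using card_mono[OF A] by (simp add: card_Diff_subset of_nat_diff)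
    then show "(\<Sum>j\<in>A - J. w (Suc (card J)) * \<phi> J) = (real (card A) - real (card J)) * w (Suc (card J)) * \<phi> J"
      by simp
  qed simp
  finally show ?thesis .
qed

text \<open>The weights are chosen so that the middle layers cancel here.\<close>

lemma weight_telescope:
  assumes l: "0 < l"
  shows "(\<Sum>J\<in>Pow {..<l}. weight l (card J) *
             ((real l + 1) * real (card J) * \<phi> J - real l * (\<Sum>j\<in>J. \<phi> (J - {j})))) =
         (real l)\<^sup>2 * ((1 + 1 / real l) ^ l * \<phi> {..<l} - \<phi> {})"
proof -
  let ?A = "{..<l}" and ?q = "1 + 1 / real l"
  \<comment> \<open>The coefficient of \<open>\<phi> J\<close> after regrouping the inner sums. By
    \<open>weight_step\<close> it vanishes strictly between the empty and the full set.\<close>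
  define c where "c J = (real l + 1) * real (card J) * weight l (card J) -
      real l * (real l - real (card J)) * weight l (Suc (card J))" for J :: "nat set"
  have "(\<Sum>J\<in>Pow ?A. weight l (card J) *
             ((real l + 1) * real (card J) * \<phi> J - real l * (\<Sum>j\<in>J. \<phi> (J - {j})))) =
     (\<Sum>J\<in>Pow ?A. (real l + 1) * real (card J) * weight l (card J) * \<phi> J) -
      real l * (\<Sum>J\<in>Pow ?A. weight l (card J) * (\<Sum>j\<in>J. \<phi> (J - {j})))"
    unfolding sum_distrib_left[of "real l" _ "Pow {..<l}"] sum_subtractf[symmetric]
    by (rule sum.cong) (simp_all add: algebra_simps)
  also have "\<dots> = (\<Sum>J\<in>Pow ?A. c J * \<phi> J)"
    unfolding sum_Pow_remove[OF finite_lessThan] sum_distrib_left[of "real l" _ "Pow {..<l}"]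
      sum_subtractf[symmetric] c_def
    by (rule sum.cong) (simp_all add: algebra_simps)
  also have "\<dots> = (\<Sum>J\<in>{{}, ?A}. c J * \<phi> J)"
  proof (rule sum.mono_neutral_right)
    show "\<forall>J\<in>Pow ?A - {{}, ?A}. c J * \<phi> J = 0"
    proof
      fix J assume J: "J \<in> Pow ?A - {{}, ?A}"
      then have "J \<subset> ?A" by auto
      then have "card J < l" using psubset_card_mono[of ?A J] by simp
      moreover have "0 < card J" using J finite_subset[of J ?A] by (auto simp: card_gt_0_iff)
      ultimately show "c J * \<phi> J = 0" using weight_step[of "card J" l] by (simp add: c_def)
    qed
  qed auto
  also have "\<dots> = c {} * \<phi> {} + c ?A * \<phi> ?A"
    using l by (subst sum.insert) (auto simp: lessThan_empty_iff)
  also have "c {} = - (real l)\<^sup>2" using l by (simp add: c_def weight_def power2_eq_square)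
  also have "c ?A = (real l)\<^sup>2 * ?q ^ l"
  proof -
    have "?q ^ l = ?q * ?q ^ (l - 1)" using l by (cases l) auto
    then show ?thesis using l by (simp add: c_def weight_def power2_eq_square field_simps)
  qed
  finally show ?thesis by (simp add: algebra_simps)
qed

section \<open>The exchange argument for local optima of the potential\<close>

text \<open>The losses are grouped by colour. Removing the whole class of \<open>j\<close> turns the
  union over \<open>J\<close> into that over \<open>J - {j}\<close> and loses at least the sum of
  the single losses; a colour outside \<open>J\<close> loses nothing.\<close>

lemma sum_losses_color_proj:
  assumes f: "nonneg_monotone_submodular V f" and X: "X \<subseteq> V \<times> {..<l}" and fin: "finite X"
    and J: "J \<subseteq> {..<l}"
  shows "(\<Sum>b\<in>X. f (color_proj J X) - f (color_proj J (X - {b}))) \<le>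
    (\<Sum>j\<in>J. f (color_proj J X) - f (color_proj (J - {j}) X))"
proof -
  let ?h = "\<lambda>Y. f (color_proj J Y)" and ?X = "\<lambda>j. {p \<in> X. snd p = j}"
  note h = nms_color_proj[OF f, of "{..<l}" J]
  have "(\<Sum>b\<in>X. ?h X - ?h (X - {b})) = (\<Sum>j\<in>{..<l}. \<Sum>b\<in>?X j. ?h X - ?h (X - {b}))"
    by (rule sum.group[symmetric]) (use fin X in auto)
  also have "\<dots> \<le> (\<Sum>j\<in>{..<l}. f (color_proj J X) - f (color_proj (J - {j}) X))"
  proof (rule sum_mono)
    fix j
    have "color_proj J (X - ?X j) = color_proj (J - {j}) X"
      by (auto simp: color_proj_def image_iff)
    then show "(\<Sum>b\<in>?X j. ?h X - ?h (X - {b})) \<le> f (color_proj J X) - f (color_proj (J - {j}) X)"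
      using sum_losses_le_loss[OF h, of "?X j" X] fin X by simp
  qed
  also have "\<dots> = (\<Sum>j\<in>J. f (color_proj J X) - f (color_proj (J - {j}) X))"
    by (rule sum.mono_neutral_right) (use J in auto)
  finally show ?thesis .
qed

text \<open>Buchbinder and Feldman: for a local optimum of the potential in the lifted matroid, adding
  the exchange inequalities for all copies of an independent set gives the factor
  \<open>1 - (1 + 1/l)\<^sup>-\<^sup>l\<close>.\<close>

lemma local_optimum_value:
  assumes m: "matroid V M" and f: "nonneg_monotone_submodular V f" and l: "0 < l"
    and X: "X \<in> lift_matroid l M" and A: "A \<in> M" and \<eta>: "0 \<le> \<eta>"
    and loc: "\<And>a j Y. a \<in> A \<Longrightarrow> j < l \<Longrightarrow> (a, j) \<notin> X \<Longrightarrow> Y \<subseteq> X \<Longrightarrow> card Y \<le> 1 \<Longrightarrow>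
        insert (a, j) (X - Y) \<in> lift_matroid l M \<Longrightarrow>
        potential l f (insert (a, j) (X - Y)) \<le> potential l f X + \<eta>"
  shows "((1 + 1 / real l) ^ l - 1) * f A \<le> (1 + 1 / real l) ^ l * f (fst ` X) + real (card A) * \<eta> / real l"
proof -
  let ?L = "{..<l}" and ?w = "\<lambda>J. weight l (card J)" and ?S = "\<lambda>J. f (color_proj J X)"
    and ?g = "potential l f"
  note XV = lift_matroid_subset[OF m X] and finX = lift_matroid_finite[OF m X]
    and AV = matroidD(3)[OF m A]
  have SL: "color_proj ?L X = fst ` X" by (rule color_proj_all) (use XV in auto)
  define \<Delta> where "\<Delta> = (\<Sum>b\<in>X. ?g X - ?g (X - {b}))"
  \<comment> \<open>\<open>X\<close> is compared with the copy of \<open>A\<close> in colour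
    \<open>j\<close>. Adding this copy makes the union over \<open>J\<close> contain
    \<open>A\<close> if \<open>j\<close> is in \<open>J\<close>; for the other \<open>J\<close>
    monotonicity suffices.\<close>
  have low: "(\<Sum>J\<in>Pow ?L. if j \<in> J then ?w J * (f A - ?S J) else 0) \<le> \<Delta> + real (card A) * \<eta>" if "j < l" for j
  proof -
    let ?A = "A \<times> {j}"
    have "?A \<in> lift_matroid l M" using A that by (auto simp: lift_matroid_def inj_on_def fst_image_times)
    from local_optimum_gain[OF matroid_lift[OF m] nms_potential[OF f, of _ l] X this, where \<eta> = \<eta>]
    have "?g (X \<union> ?A) - ?g X \<le> \<Delta> + real (card ?A) * \<eta>"
      using loc that \<eta> by (force simp: \<Delta>_def)
    moreover have "(\<Sum>J\<in>Pow ?L. if j \<in> J then ?w J * (f A - ?S J) else 0) \<le> ?g (X \<union> ?A) - ?g X"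
      unfolding potential_def sum_subtractf[symmetric] right_diff_distrib[symmetric]
    proof (rule sum_mono)
      fix J
      have "j \<in> J \<Longrightarrow> color_proj J ?A = A" by (force simp: color_proj_def)
      moreover have "?S J \<le> f (color_proj J (X \<union> ?A))"
        by (rule nmsD(2)[OF f color_proj_mono color_proj_subset[of _ _ UNIV]]) (use XV AV in auto)
      moreover have "f A \<le> f (color_proj J (X \<union> ?A))" if "j \<in> J"
        by (rule nmsD(2)[OF f _ color_proj_subset[of _ _ UNIV]])
          (use XV AV calculation(1)[OF that] in \<open>auto simp: color_proj_Un\<close>)
      ultimately show "(if j \<in> J then ?w J * (f A - ?S J) else 0) \<le>
          ?w J * (f (color_proj J (X \<union> ?A)) - ?S J)"
        using weight_nonneg[of l "card J"] by (auto intro!: mult_left_mono mult_nonneg_nonneg)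
    qed
    ultimately show ?thesis by (simp add: card_cartesian_product)
  qed
  \<comment> \<open>Summed over all colours, the term of \<open>J\<close> is counted once for each
    member of \<open>J\<close>.\<close>
  have "(\<Sum>J\<in>Pow ?L. ?w J * (real (card J) * (f A - ?S J))) =
      (\<Sum>J\<in>Pow ?L. \<Sum>j\<in>?L. if j \<in> J then ?w J * (f A - ?S J) else 0)"
    by (rule sum.cong) (auto simp: sum.If_cases Int_absorb1)
  also have "\<dots> = (\<Sum>j\<in>?L. \<Sum>J\<in>Pow ?L. if j \<in> J then ?w J * (f A - ?S J) else 0)"
    by (rule sum.swap)
  also have "\<dots> \<le> (\<Sum>j\<in>?L. \<Delta> + real (card A) * \<eta>)"
    by (rule sum_mono) (use low in auto)
  also have "\<dots> = real l * \<Delta> + real l * real (card A) * \<eta>" by (simp add: algebra_simps)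
  finally have main: "(\<Sum>J\<in>Pow ?L. ?w J * (real (card J) * (f A - ?S J))) \<le>
      real l * \<Delta> + real l * real (card A) * \<eta>" .
  have "\<Delta> = (\<Sum>b\<in>X. \<Sum>J\<in>Pow ?L. ?w J * (?S J - f (color_proj J (X - {b}))))"
    unfolding \<Delta>_def potential_def sum_subtractf[symmetric] right_diff_distrib[symmetric] ..
  also have "\<dots> = (\<Sum>J\<in>Pow ?L. ?w J * (\<Sum>b\<in>X. ?S J - f (color_proj J (X - {b}))))"
    by (subst sum.swap) (simp add: sum_distrib_left)
  also have "\<dots> \<le> (\<Sum>J\<in>Pow ?L. ?w J * (\<Sum>j\<in>J. ?S J - ?S (J - {j})))"
    by (intro sum_mono mult_left_mono weight_nonneg sum_losses_color_proj[OF f XV finX]) auto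
  finally have "real l * \<Delta> \<le> real l * (\<Sum>J\<in>Pow ?L. ?w J * (\<Sum>j\<in>J. ?S J - ?S (J - {j})))"
    by (intro mult_left_mono) auto
  with main have "(\<Sum>J\<in>Pow ?L. ?w J * (real (card J) * (f A - ?S J))) \<le>
     real l * (\<Sum>J\<in>Pow ?L. ?w J * (\<Sum>j\<in>J. ?S J - ?S (J - {j}))) + real l * real (card A) * \<eta>"
    by simp
  \<comment> \<open>As card J = (l + 1) card J - l card J, the terms with \<open>f A\<close> also
    take the shape of \<open>weight_telescope\<close>, which is applied to \<open>?S\<close> and to
    the constant \<open>f A\<close>.\<close>
  moreover have "real l * (\<Sum>J\<in>Pow ?L. ?w J * (\<Sum>j\<in>J. ?S J - ?S (J - {j}))) -
      (\<Sum>J\<in>Pow ?L. ?w J * (real (card J) * (f A - ?S J))) =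
     (\<Sum>J\<in>Pow ?L. ?w J * ((real l + 1) * real (card J) * ?S J - real l * (\<Sum>j\<in>J. ?S (J - {j}))))
      - (\<Sum>J\<in>Pow ?L. ?w J * ((real l + 1) * real (card J) * f A - real l * (\<Sum>j\<in>J. f A)))"
    unfolding sum_distrib_left[of "real l" _ "Pow {..<l}"] sum_subtractf[symmetric]
    by (rule sum.cong) (simp_all add: sum_subtractf algebra_simps)
  moreover have "\<dots> = (real l)\<^sup>2 * ((1 + 1 / real l) ^ l * f (fst ` X) - ?S {})
      - (real l)\<^sup>2 * ((1 + 1 / real l) ^ l * f A - f A)"
    unfolding weight_telescope[OF l, of ?S] weight_telescope[OF l, of "\<lambda>_. f A"]
    unfolding SL ..
  moreover have "0 \<le> (real l)\<^sup>2 * ?S {}"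
    by (intro mult_nonneg_nonneg nmsD(1)[OF f]) (auto simp: color_proj_def)
  ultimately have "(real l)\<^sup>2 * (((1 + 1 / real l) ^ l - 1) * f A) \<le>
      (real l)\<^sup>2 * ((1 + 1 / real l) ^ l * f (fst ` X)) + real l * real (card A) * \<eta>"
    by (simp add: algebra_simps)
  also have "\<dots> = (real l)\<^sup>2 * ((1 + 1 / real l) ^ l * f (fst ` X) + real (card A) * \<eta> / real l)"
    using l by (simp add: field_simps power2_eq_square)
  finally show ?thesis using l by simp
qed

section \<open>Size of the potential\<close>

text \<open>The telescoping identity for the constant 1 evaluates the sum of weight times
  cardinality; the extra factor \<open>card J\<close> only enlarges the terms, since the empty set
  has weight 0. The power of 1 + 1/l is the one in \<open>potential_singleton_ge\<close>, so it
  cancels when the two bounds are compared.\<close>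

lemma potential_le:
  assumes m: "matroid V M" and f: "nonneg_monotone_submodular V f" and l: "0 < l"
    and X: "X \<in> lift_matroid l M"
  shows "potential l f X \<le> (real l)\<^sup>2 * (1 + 1 / real l) ^ (l - 1) * f (fst ` X)"
proof -
  let ?L = "{..<l}" and ?w = "\<lambda>J. weight l (card J)" and ?q = "1 + 1 / real l"
  have fX: "fst ` X \<subseteq> V" using lift_matroid_subset[OF m X] by auto
  have "?q ^ l = ?q ^ (l - 1) + ?q ^ (l - 1) / real l"
    using l power_Suc[of ?q "l - 1"] by (simp add: distrib_right)
  moreover have "?q ^ (l - 1) \<le> real l"
  proof -
    have "?q ^ n \<le> real (Suc n)" if "n \<le> l" for n
      using that
    proof (induction n)
      case (Suc n)
      have "?q ^ Suc n = ?q ^ n + ?q ^ n / real l" by (simp add: field_simps)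
      also have "?q ^ n / real l \<le> 1" using Suc l by (simp add: divide_le_eq)
      finally show ?case using Suc by simp
    qed simp
    from this[of "l - 1"] show ?thesis using l by simp
  qed
  ultimately have q: "?q ^ l - 1 \<le> ?q ^ (l - 1)" using l by (simp add: divide_le_eq)
  have "potential l f X \<le> (\<Sum>J\<in>Pow ?L. ?w J * real (card J) * f (fst ` X))"
    unfolding potential_def
  proof (rule sum_mono)
    fix J assume "J \<in> Pow ?L"
    then have finJ: "finite J" using finite_subset by auto
    have 1: "f (color_proj J X) \<le> f (fst ` X)"
      by (rule nmsD(2)[OF f color_proj_subset_image fX])
    show "?w J * f (color_proj J X) \<le> ?w J * real (card J) * f (fst ` X)"
    proof (cases "card J = 0")
      case True then show ?thesis by (simp add: weight_def)
    next
      case False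
      then have "1 * f (fst ` X) \<le> real (card J) * f (fst ` X)"
        by (intro mult_right_mono nmsD(1)[OF f fX]) simp
      with 1 have "f (color_proj J X) \<le> real (card J) * f (fst ` X)" by simp
      then show ?thesis unfolding mult.assoc by (intro mult_left_mono weight_nonneg)
    qed
  qed
  also have "\<dots> = (\<Sum>J\<in>Pow ?L. ?w J * ((real l + 1) * real (card J) * 1 - real l * (\<Sum>j\<in>J. 1))) * f (fst ` X)"
    unfolding sum_distrib_right by (rule sum.cong) (simp_all add: algebra_simps)
  also have "\<dots> = (real l)\<^sup>2 * (?q ^ l - 1) * f (fst ` X)"
    unfolding weight_telescope[OF l, of "\<lambda>_. 1"] by simp
  also have "\<dots> \<le> (real l)\<^sup>2 * ?q ^ (l - 1) * f (fst ` X)"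
    by (intro mult_right_mono mult_left_mono q nmsD(1)[OF f fX]) auto
  finally show ?thesis .
qed

lemma potential_singleton_ge:
  assumes f: "nonneg_monotone_submodular V f" and l: "0 < l" and e: "e \<in> V"
  shows "(1 + 1 / real l) ^ (l - 1) * f {e} \<le> potential l f {(e, 0)}"
proof -
  have "(1 + 1 / real l) ^ (l - 1) * f {e} =
      (\<Sum>J\<in>{{..<l}}. weight l (card J) * f (color_proj J {(e, 0)}))"
    using l color_proj_all[of "{(e, 0)}" "{..<l}"] by (simp add: weight_def)
  also have "\<dots> \<le> potential l f {(e, 0)}"
    unfolding potential_def
    by (rule sum_mono2)
      (use e in \<open>auto intro!: mult_nonneg_nonneg weight_nonneg nmsD(1)[OF f] color_proj_subset[of _ V UNIV]\<close>)
  finally show ?thesis .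
qed

section \<open>Deterministic programs\<close>

text \<open>The programs below never draw, so their executions are point masses and no probabilities
  remain.\<close>

definition runs :: "('a set \<Rightarrow> real) \<Rightarrow> 'a set set \<Rightarrow> ('a, 'r) prog \<Rightarrow> 'r \<Rightarrow> 'a set list \<Rightarrow> bool" where
  "runs f M p r qs \<longleftrightarrow> exec f M p = return_pmf (r, qs)"

lemma runs_Return: "runs f M (Return r) r []"
  by (simp add: runs_def)

lemma runs_Query_Value: "runs f M (c (f S)) r qs \<Longrightarrow> runs f M (Query_Value S c) r (S # qs)"
  by (simp add: runs_def)

lemma runs_Query_Member: "runs f M (c (S \<in> M)) r qs \<Longrightarrow> runs f M (Query_Member S c) r (S # qs)"
  by (simp add: runs_def)

lemma exec_map_prog: "exec f M (map_prog h p) = map_pmf (map_prod h id) (exec f M p)"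
  by (induction p)
    (auto simp: pmf.map_comp map_bind_pmf comp_def case_prod_beta map_prod_def intro!: map_pmf_cong bind_pmf_cong)

lemma runs_map_prog: "runs f M p r qs \<Longrightarrow> runs f M (map_prog h p) (h r) qs"
  by (simp add: runs_def exec_map_prog)

definition list_of :: "'b set \<Rightarrow> 'b list" where
  "list_of A = (SOME xs. set xs = A \<and> distinct xs)"

lemma list_of:
  assumes "finite A"
  shows "set (list_of A) = A" "length (list_of A) = card A"
proof -
  have "set (list_of A) = A \<and> distinct (list_of A)"
    unfolding list_of_def by (rule someI_ex) (use finite_distinct_list[OF assms] in blast)
  then show "set (list_of A) = A" "length (list_of A) = card A"
    using distinct_card by force+
qed

text \<open>The continuation \<open>k\<close> takes the place of a monadic bind, here and in the
  programs that follow; \<open>F\<close> collects the answers.\<close>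

primrec ask :: "'a set list \<Rightarrow> ('a set \<Rightarrow> real) \<Rightarrow> (('a set \<Rightarrow> real) \<Rightarrow> ('a, 'r) prog) \<Rightarrow> ('a, 'r) prog"
where
  "ask [] F k = k F"
| "ask (S # Ss) F k = Query_Value S (\<lambda>y. ask Ss (F(S := y)) k)"

text \<open>The continuation may rely on the values asked for and on those already right in
  \<open>F\<close>. The latter carries the recorded answers through the induction, also when a set
  occurs twice.\<close>

lemma runs_ask:
  assumes "\<And>F'. (\<forall>S. S \<in> set Ss \<or> F S = f S \<longrightarrow> F' S = f S) \<Longrightarrow> runs f M (k F') r qs"
  shows "runs f M (ask Ss F k) r (Ss @ qs)"
  using assms
proof (induction Ss arbitrary: F)
  case (Cons S Ss)
  have "runs f M (ask Ss (F(S := f S)) k) r (Ss @ qs)"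
    by (rule Cons.IH, rule Cons.prems) auto
  then show ?case by (simp add: runs_Query_Value)
qed simp

definition eval_potential :: "nat \<Rightarrow> ('a \<times> nat) set \<Rightarrow> (real \<Rightarrow> ('a, 'r) prog) \<Rightarrow> ('a, 'r) prog" where
  "eval_potential l X k =
     ask (map (\<lambda>J. color_proj J X) (list_of (Pow {..<l}))) (\<lambda>_. 0) (\<lambda>F. k (potential l F X))"

lemma runs_eval_potential:
  assumes "runs f M (k (potential l f X)) r qs" and "fst ` X \<subseteq> W"
  shows "\<exists>ps. runs f M (eval_potential l X k) r (ps @ qs) \<and> length ps = 2 ^ l \<and> (\<forall>Q\<in>set ps. Q \<subseteq> W)"
proof -
  let ?L = "list_of (Pow {..<l})"
  have L: "set ?L = Pow {..<l}" "length ?L = 2 ^ l"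
    using list_of[of "Pow {..<l}"] by (simp_all add: card_Pow)
  have "runs f M (eval_potential l X k) r (map (\<lambda>J. color_proj J X) ?L @ qs)"
    unfolding eval_potential_def
  proof (rule runs_ask)
    fix F' assume "\<forall>S. S \<in> set (map (\<lambda>J. color_proj J X) ?L) \<or> 0 = f S \<longrightarrow> F' S = f S"
    then have "potential l F' X = potential l f X"
      unfolding potential_def using L(1) by (intro sum.cong) auto
    then show "runs f M (k (potential l F' X)) r qs" using assms(1) by simp
  qed
  then show ?thesis
    using L assms(2) by (intro exI[of _ "map (\<lambda>J. color_proj J X) ?L"]) (auto simp: color_proj_def)
qed

primrec search :: "nat \<Rightarrow> real \<Rightarrow> ('a \<times> nat) set \<Rightarrow> ('a \<times> nat) set list \<Rightarrow>
    (('a \<times> nat) set option \<Rightarrow> ('a, 'r) prog) \<Rightarrow> ('a, 'r) prog" where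
  "search l \<kappa> X [] k = k None"
| "search l \<kappa> X (Z # Zs) k = Query_Member (fst ` Z) (\<lambda>b.
     if b then eval_potential l X (\<lambda>x. eval_potential l Z (\<lambda>z.
       if \<kappa> * x < z then k (Some Z) else search l \<kappa> X Zs k))
     else search l \<kappa> X Zs k)"

text \<open>Each candidate costs one membership query and at most two evaluations of the potential,
  because that of \<open>X\<close> is evaluated anew every time.\<close>

lemma runs_search:
  assumes "runs f M (k (find (\<lambda>Z. fst ` Z \<in> M \<and> \<kappa> * potential l f X < potential l f Z) Zs)) r qs"
    and "fst ` X \<subseteq> W" "\<forall>Z\<in>set Zs. fst ` Z \<subseteq> W"
  shows "\<exists>ps. runs f M (search l \<kappa> X Zs k) r (ps @ qs) \<and> length ps \<le> length Zs * (1 + 2 * 2 ^ l) \<and>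
           (\<forall>Q\<in>set ps. Q \<subseteq> W)"
  using assms(1,3)
proof (induction Zs)
  case Nil
  then show ?case by (intro exI[of _ "[]"]) simp
next
  case (Cons Z Zs)
  let ?better = "\<kappa> * potential l f X < potential l f Z"
  show ?case
  proof (cases "fst ` Z \<in> M")
    case False
    then obtain ps where "runs f M (search l \<kappa> X Zs k) r (ps @ qs)"
      "length ps \<le> length Zs * (1 + 2 * 2 ^ l)" "\<forall>Q\<in>set ps. Q \<subseteq> W"
      using Cons by auto
    with False Cons.prems show ?thesis
      by (intro exI[of _ "fst ` Z # ps"]) (auto intro!: runs_Query_Member)
  next
    case True
    let ?k = "if ?better then k (Some Z) else search l \<kappa> X Zs k"
    obtain ps where ps: "runs f M ?k r (ps @ qs)"
      "length ps \<le> length Zs * (1 + 2 * 2 ^ l)" "\<forall>Q\<in>set ps. Q \<subseteq> W"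
    proof (cases ?better)
      case True
      then show thesis using Cons.prems \<open>fst ` Z \<in> M\<close> by (intro that[of "[]"]) auto
    next
      case False
      then show thesis using Cons \<open>fst ` Z \<in> M\<close> that by auto
    qed
    have "fst ` Z \<subseteq> W" using Cons.prems by simp
    from runs_eval_potential[where k = "\<lambda>z. if \<kappa> * potential l f X < z then k (Some Z) else search l \<kappa> X Zs k", OF ps(1) this]
    obtain ps2 where ps2: "runs f M (eval_potential l Z
          (\<lambda>z. if \<kappa> * potential l f X < z then k (Some Z) else search l \<kappa> X Zs k)) r (ps2 @ ps @ qs)"
        "length ps2 = 2 ^ l" "\<forall>Q\<in>set ps2. Q \<subseteq> W" by blast
    from runs_eval_potential[where k = "\<lambda>x. eval_potential l Z
          (\<lambda>z. if \<kappa> * x < z then k (Some Z) else search l \<kappa> X Zs k)", OF ps2(1) assms(2)]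
    obtain ps1 where ps1: "runs f M (eval_potential l X (\<lambda>x. eval_potential l Z
          (\<lambda>z. if \<kappa> * x < z then k (Some Z) else search l \<kappa> X Zs k))) r (ps1 @ ps2 @ ps @ qs)"
        "length ps1 = 2 ^ l" "\<forall>Q\<in>set ps1. Q \<subseteq> W" by blast
    have "runs f M (search l \<kappa> X (Z # Zs) k) r ((fst ` Z # ps1 @ ps2 @ ps) @ qs)"
      using ps1(1) True by (auto intro!: runs_Query_Member)
    then show ?thesis using ps ps1 ps2 Cons.prems
      by (intro exI[of _ "fst ` Z # ps1 @ ps2 @ ps"]) auto
  qed
qed

section \<open>The local search\<close>

text \<open>Insertions and swaps. Injectivity forces out an old copy of \<open>e\<close>, so
  recolouring counts as a swap. It is checked without queries, so that one membership query for the
  projection decides independence in the lifted matroid.\<close>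

definition moves :: "nat \<Rightarrow> ('a \<times> nat) set \<Rightarrow> 'a \<Rightarrow> ('a \<times> nat) set set" where
  "moves l X e = {insert (e, j) (X - Y) |j Y. j < l \<and> Y \<subseteq> X \<and> card Y \<le> 1 \<and> inj_on fst (insert (e, j) (X - Y))}"

lemma moves_finite:
  assumes "finite X"
  shows "finite (moves l X e)" "card (moves l X e) \<le> l * (card X + 1)"
proof -
  let ?Y = "insert {} ((\<lambda>x. {x}) ` X)"
  have Yi: "Y \<in> ?Y" if "Y \<subseteq> X" "card Y \<le> 1" for Y
  proof (cases "card Y = 0")
    case True
    then show ?thesis using that finite_subset[OF that(1) assms] by simp
  next
    case False
    with that(2) have "card Y = 1" by simp
    then obtain y where "Y = {y}" by (rule card_1_singletonE)
    with that(1) show ?thesis by auto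
  qed
  have s: "moves l X e \<subseteq> (\<lambda>(j, Y). insert (e, j) (X - Y)) ` ({..<l} \<times> ?Y)"
  proof
    fix Z assume "Z \<in> moves l X e"
    then obtain j Y where "j < l" "Y \<subseteq> X" "card Y \<le> 1" "Z = insert (e, j) (X - Y)"
      unfolding moves_def by blast
    with Yi[of Y] show "Z \<in> (\<lambda>(j, Y). insert (e, j) (X - Y)) ` ({..<l} \<times> ?Y)"
      by (intro image_eqI[of _ _ "(j, Y)"]) simp_all
  qed
  have fin: "finite ({..<l} \<times> ?Y)" using assms by simp
  show "finite (moves l X e)" using finite_subset[OF s finite_imageI[OF fin]] .
  have "card (moves l X e) \<le> card ({..<l} \<times> ?Y)"
    using card_mono[OF finite_imageI[OF fin] s] card_image_le[OF fin] by (rule order_trans)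
  also have "\<dots> = l * card ?Y" by (simp add: card_cartesian_product)
  also have "card ?Y \<le> card X + 1"
    using card_insert_le_m1[of "card X + 1" "(\<lambda>x. {x}) ` X" "{}"] card_image_le[OF assms, of "\<lambda>x. {x}"] by simp
  finally show "card (moves l X e) \<le> l * (card X + 1)" by simp
qed

lemma fst_moves: "Z \<in> moves l X e \<Longrightarrow> fst ` Z \<subseteq> insert e (fst ` X)"
  by (auto simp: moves_def)

definition all_moves :: "nat \<Rightarrow> ('a \<times> nat) set \<Rightarrow> 'a list \<Rightarrow> ('a \<times> nat) set list" where
  "all_moves l X es = concat (map (\<lambda>e. list_of (moves l X e)) es)"

lemma set_all_moves: "finite X \<Longrightarrow> set (all_moves l X es) = (\<Union>e\<in>set es. moves l X e)"
  by (simp add: all_moves_def list_of moves_finite)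

lemma length_all_moves:
  assumes "finite X"
  shows "length (all_moves l X es) \<le> length es * (l * (card X + 1))"
proof (induction es)
  case (Cons e es)
  have "length (list_of (moves l X e)) \<le> l * (card X + 1)"
    using moves_finite[OF assms] by (simp add: list_of)
  with Cons show ?case by (simp add: all_moves_def)
qed (simp add: all_moves_def)

text \<open>The counter is fuel: a \<open>prog\<close> must be finite on every branch, and its type
  allows arbitrary oracle answers.\<close>

primrec improve :: "nat \<Rightarrow> real \<Rightarrow> 'a list \<Rightarrow> nat \<Rightarrow> ('a \<times> nat) set \<Rightarrow>
    (('a \<times> nat) set \<Rightarrow> ('a, 'r) prog) \<Rightarrow> ('a, 'r) prog" where
  "improve l \<kappa> es 0 X k = k X"
| "improve l \<kappa> es (Suc n) X k = search l \<kappa> X (all_moves l X es)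
     (\<lambda>res. case res of None \<Rightarrow> k X | Some Z \<Rightarrow> improve l \<kappa> es n Z k)"

text \<open>A state consists of the non-loops seen so far (latest first), their values, a maximal
  independent subset of them, whose size is the current rank, and the current solution with its
  elements coloured by \<open>{..<l}\<close>.\<close>

type_synonym 'a state = "'a list \<times> ('a \<Rightarrow> real) \<times> 'a set \<times> ('a \<times> nat) set"

definition solution :: "'a state \<Rightarrow> 'a set" where
  "solution s = fst ` snd (snd (snd s))"

definition best :: "('a \<Rightarrow> real) \<Rightarrow> 'a list \<Rightarrow> 'a" where
  "best v es = (SOME b. b \<in> set es \<and> (\<forall>e\<in>set es. v e \<le> v b))"

text \<open>Elements below the threshold contribute at most a \<open>1/l\<close> fraction of the optimum in total.\<close>

definition alive :: "nat \<Rightarrow> nat \<Rightarrow> ('a \<Rightarrow> real) \<Rightarrow> 'a list \<Rightarrow> 'a list" where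
  "alive l r v es = filter (\<lambda>e. v (best v es) \<le> real l * real r * v e) es"

text \<open>At most \<open>r\<close> exchange inequalities each lose a 1/(l^2 r) fraction of the
  potential. Together this is at most \<open>(1 + 1/l)^(l-1)\<close> times the value of the solution
  by \<open>potential_le\<close>, and \<open>local_optimum_value\<close> divides it by
  \<open>l\<close>.\<close>

definition improvement_factor :: "nat \<Rightarrow> nat \<Rightarrow> real" where
  "improvement_factor l r = 1 + 1 / ((real l)\<^sup>2 * real r)"

text \<open>The number of iterations suffices by Bernoulli's inequality, since the potential of the
  solution is initially within a factor \<open>2 l\<^sup>2 r\<close> of its maximum.\<close>

definition improve_all :: "nat \<Rightarrow> 'a list \<Rightarrow> ('a \<Rightarrow> real) \<Rightarrow> 'a set \<Rightarrow> ('a \<times> nat) set \<Rightarrow>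
    ('a, 'a set \<times> 'a state) prog" where
  "improve_all l es v R X =
     improve l (improvement_factor l (card R)) (alive l (card R) v es) (2 * l ^ 4 * (card R)\<^sup>2) X
       (\<lambda>X'. Return (solution (es, v, R, X'), (es, v, R, X')))"

text \<open>While the rank is at most 1 the query bound leaves no room for a factor depending on \<open>l\<close>, so the
  best element is then tracked without evaluating the potential. Afterwards the solution is reset
  to the new element if that doubles the potential, and the older elements are scanned again only
  if the rank or the solution has changed.\<close>

definition update :: "nat \<Rightarrow> 'a list \<Rightarrow> ('a \<Rightarrow> real) \<Rightarrow> 'a set \<Rightarrow> bool \<Rightarrow> ('a \<times> nat) set \<Rightarrow> 'a \<Rightarrow>
    ('a, 'a set \<times> 'a state) prog" where
  "update l es v R grown X e =
     (if card R \<le> 1 then Return (solution (es, v, R, {(best v es, 0)}), (es, v, R, {(best v es, 0)}))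
      else eval_potential l X (\<lambda>x.
        if 2 * x < (1 + 1 / real l) ^ (l - 1) * v e then improve_all l es v R {(e, 0)}
        else if grown then improve_all l es v R X
        else search l (improvement_factor l (card R)) X (all_moves l X [e]) (\<lambda>res. case res of
            None \<Rightarrow> Return (solution (es, v, R, X), (es, v, R, X))
          | Some Z \<Rightarrow> improve_all l es v R Z)))"

text \<open>Loops never enter the state. The test \<open>e \<notin> R\<close> matters when an
  element is inserted again: \<open>insert e R\<close> may then be independent although the rank
  does not grow.\<close>

fun step :: "nat \<Rightarrow> 'a state \<Rightarrow> 'a \<Rightarrow> ('a, 'a set \<times> 'a state) prog" where
  "step l (es, v, R, X) e = Query_Member {e} (\<lambda>b.
     if b then Query_Value {e} (\<lambda>y. Query_Member (insert e R) (\<lambda>b'.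
       update l (e # es) (v(e := y)) (if b' then insert e R else R) (b' \<and> e \<notin> R) X e))
     else Return (solution (es, v, R, X), (es, v, R, X)))"

primcorec local_search :: "nat \<Rightarrow> 'a state \<Rightarrow> 'a algorithm" where
  "react (local_search l s) = (\<lambda>e. map_prog (map_prod id (local_search l)) (step l s e))"

section \<open>From one round to the whole stream\<close>

text \<open>The invariant carries the number of queries so far, so that one induction yields the
  outputs, the queried sets and the total count.\<close>

lemma run_local_search:
  assumes step: "\<And>es s c e. I es s c \<Longrightarrow> set (es @ [e]) \<subseteq> V \<Longrightarrow>
      \<exists>s' qs. runs f M (step l s e) (solution s', s') qs \<and> I (es @ [e]) s' (c + length qs) \<and>
        (\<forall>Q\<in>set qs. Q \<subseteq> set (es @ [e]))"
    and "I es s c" "set (es @ es') \<subseteq> V"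
  shows "\<exists>rs. run f M (local_search l s) es' = return_pmf rs \<and>
    (\<forall>i<length es'. (\<exists>s' c'. fst (rs ! i) = solution s' \<and> I (es @ take (Suc i) es') s' c') \<and>
       (\<forall>Q\<in>set (snd (rs ! i)). Q \<subseteq> set (es @ take (Suc i) es'))) \<and>
    (\<exists>s'. I (es @ es') s' (c + total_queries rs))"
  using assms(2,3)
  supply split_paired_Ex [simp del]
proof (induction es' arbitrary: es s c)
  case Nil
  then show ?case by (auto simp: total_queries_def)
next
  case (Cons e es')
  from step[OF Cons.prems(1), of e] Cons.prems(2) obtain s' qs where
    s': "runs f M (step l s e) (solution s', s') qs" "I (es @ [e]) s' (c + length qs)"
      "\<forall>Q\<in>set qs. Q \<subseteq> set (es @ [e])" by auto
  from Cons.IH[OF s'(2)] Cons.prems(2) obtain rs where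
    rs: "run f M (local_search l s') es' = return_pmf rs"
      "\<And>i. i < length es' \<Longrightarrow> (\<exists>s'' c'. fst (rs ! i) = solution s'' \<and> I ((es @ [e]) @ take (Suc i) es') s'' c') \<and>
       (\<forall>Q\<in>set (snd (rs ! i)). Q \<subseteq> set ((es @ [e]) @ take (Suc i) es'))"
      "\<exists>s''. I ((es @ [e]) @ es') s'' (c + length qs + total_queries rs)" by auto
  have "exec f M (react (local_search l s) e) = return_pmf ((solution s', local_search l s'), qs)"
    using runs_map_prog[OF s'(1), of "map_prod id (local_search l)"] by (simp add: runs_def)
  then have "run f M (local_search l s) (e # es') = return_pmf ((solution s', qs) # rs)"
    by (simp add: bind_return_pmf rs(1))
  moreover have "(\<exists>s'' c'. fst (((solution s', qs) # rs) ! i) = solution s'' \<and> I (es @ take (Suc i) (e # es')) s'' c') \<and>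
       (\<forall>Q\<in>set (snd (((solution s', qs) # rs) ! i)). Q \<subseteq> set (es @ take (Suc i) (e # es')))"
    if "i < length (e # es')" for i
  proof (cases i)
    case 0
    then show ?thesis using s'(2,3) by auto
  next
    case (Suc i')
    then show ?thesis using rs(2)[of i'] that by simp
  qed
  moreover have "\<exists>s''. I (es @ e # es') s'' (c + total_queries ((solution s', qs) # rs))"
    using rs(3) by (simp add: total_queries_def add.assoc)
  ultimately show ?case by blast
qed

section \<open>Approximation ratio\<close>

lemma best:
  assumes "es \<noteq> []"
  shows "best v es \<in> set es" "\<And>e. e \<in> set es \<Longrightarrow> v e \<le> v (best v es)"
proof -
  have "Max (v ` set es) \<in> v ` set es" using assms by (intro Max_in) auto
  then obtain b where "b \<in> set es" "v b = Max (v ` set es)" by auto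
  then have "\<exists>b. b \<in> set es \<and> (\<forall>e\<in>set es. v e \<le> v b)" by (intro exI[of _ b]) auto
  then have "best v es \<in> set es \<and> (\<forall>e\<in>set es. v e \<le> v (best v es))"
    unfolding best_def by (rule someI_ex)
  then show "best v es \<in> set es" "\<And>e. e \<in> set es \<Longrightarrow> v e \<le> v (best v es)" by auto
qed

text \<open>Comparison with the maximum is comparison with every element. In this form it is plain
  that at a fixed rank further insertions can only remove older elements.\<close>

lemma set_alive: "set (alive l r v es) = {e \<in> set es. \<forall>b\<in>set es. v b \<le> real l * real r * v e}"
proof (cases "es = []")
  case False
  note b = best[OF this, where v = v]
  have "v (best v es) \<le> real l * real r * v e \<longleftrightarrow> (\<forall>b\<in>set es. v b \<le> real l * real r * v e)" for e
    using b order_trans by blast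
  then show ?thesis by (simp add: alive_def)
qed (simp add: alive_def)

lemma sum_list_of_bool: "(\<Sum>x\<leftarrow>xs. of_bool (x \<in> set (filter P xs))) = real (length (filter P xs))"
proof -
  have eq: "map (\<lambda>x. of_bool (x \<in> set (filter P xs)) :: real) xs = map (\<lambda>x. of_bool (P x)) xs" by simp
  show ?thesis unfolding eq by (induction xs) auto
qed

text \<open>From ln (1 + 1/l) \<ge> 1/(l + 1) follows (1 + 1/l)^(l + 1) \<ge> e; one factor 1 + 1/l
  is then moved to the other side.\<close>

lemma inverse_power_le_exp:
  assumes "0 < l"
  shows "1 / (1 + 1 / real l) ^ l \<le> 1 / exp 1 + 1 / real l"
proof -
  let ?q = "1 + 1 / real l"
  have q0: "0 < ?q" by (simp add: add_pos_nonneg)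
  have "1 / (real l + 1) = 1 - 1 / ?q" using assms by (simp add: field_simps)
  also have "\<dots> \<le> ln ?q" using ln_le_minus_one[of "1 / ?q"] q0 ln_div[of 1 ?q] by simp
  finally have "1 \<le> ln ?q * (real l + 1)" using assms by (simp add: divide_le_eq)
  then have "exp 1 \<le> exp (ln ?q * real (Suc l))" by (simp add: add.commute)
  also have "\<dots> = ?q ^ Suc l" 
    using exp_of_nat2_mult[of "ln ?q" "Suc l"] q0 by (simp only: exp_ln)
  finally have "1 / ?q ^ l \<le> ?q / exp 1" by (simp add: field_simps add_pos_nonneg)
  also have "\<dots> = 1 / exp 1 + 1 / real l / exp 1" by (simp add: add_divide_distrib)
  also have "1 / real l / exp 1 \<le> 1 / real l"
    using assms exp_ge_add_one_self[of 1] by (simp add: divide_le_eq)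
  finally show ?thesis by simp
qed

lemma improvement_factor_gt_1: "0 < l \<Longrightarrow> 0 < r \<Longrightarrow> 1 < improvement_factor l r"
  by (simp add: improvement_factor_def)

lemma improvement_factor_antimono:
  "0 < l \<Longrightarrow> 0 < r \<Longrightarrow> r \<le> k \<Longrightarrow> improvement_factor l k \<le> improvement_factor l r"
  by (simp add: improvement_factor_def frac_le mult_left_mono)

lemma improvement_factor_le_2: "0 < l \<Longrightarrow> 0 < r \<Longrightarrow> improvement_factor l r \<le> 2"
proof -
  assume "0 < l" "0 < r"
  then have "1 \<le> (real l)\<^sup>2 * real r" using mult_mono[of 1 "(real l)\<^sup>2" 1 "real r"] by simp
  then show ?thesis by (simp add: improvement_factor_def divide_le_eq)
qed

section \<open>A fixed instance: conditions on the state and value of the solution\<close>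

locale local_search_instance =
  fixes V :: "'a set" and M :: "'a set set" and f :: "'a set \<Rightarrow> real" and l :: nat
  assumes mat: "matroid V M" and nms: "nonneg_monotone_submodular V f" and l: "0 < l"
begin

abbreviation "g \<equiv> potential l f"

definition k :: nat where "k = matroid_rank M"

definition a :: real where "a = (1 + 1 / real l) ^ (l - 1)"

lemma a_ge_1: "1 \<le> a"
  by (simp add: a_def one_le_power)

lemma card_le_k:
  assumes "T \<in> M"
  shows "card T \<le> k"
proof -
  have "finite M" using mat finite_subset[of M "Pow V"] by (auto simp: matroid_def)
  then show ?thesis unfolding k_def matroid_rank_def using assms by (intro Max_ge) auto
qed

text \<open>\<open>D\<close> stands for the inserted elements, and \<open>R\<close> is a basis of
  them, so \<open>card R\<close> is their rank. The last conjunct is what resetting maintains; it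
  bounds the levels with which a new element starts.\<close>

definition core :: "'a set \<Rightarrow> 'a list \<Rightarrow> ('a \<Rightarrow> real) \<Rightarrow> 'a set \<Rightarrow> ('a \<times> nat) set \<Rightarrow> bool" where
  "core D es v R X \<longleftrightarrow>
     D \<subseteq> V \<and> set es = {e \<in> D. {e} \<in> M} \<and> (\<forall>e\<in>set es. v e = f {e}) \<and>
     R \<in> M \<and> R \<subseteq> D \<and> (\<forall>e\<in>D. insert e R \<in> M \<longrightarrow> e \<in> R) \<and>
     X \<in> lift_matroid l M \<and> fst ` X \<subseteq> set es \<and> (\<forall>e\<in>set es. a * f {e} \<le> 2 * g X)"

definition locally_optimal :: "'a list \<Rightarrow> ('a \<Rightarrow> real) \<Rightarrow> 'a set \<Rightarrow> ('a \<times> nat) set \<Rightarrow> bool" where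
  "locally_optimal es v R X \<longleftrightarrow> (\<forall>e\<in>set (alive l (card R) v es). \<forall>Z\<in>moves l X e.
      fst ` Z \<in> M \<longrightarrow> g Z \<le> improvement_factor l (card R) * g X)"

definition settled :: "'a set \<Rightarrow> 'a list \<Rightarrow> ('a \<Rightarrow> real) \<Rightarrow> 'a set \<Rightarrow> ('a \<times> nat) set \<Rightarrow> bool" where
  "settled D es v R X \<longleftrightarrow>
     (if card R \<le> 1 then \<forall>T\<in>M. T \<subseteq> D \<longrightarrow> f T \<le> f (fst ` X) else locally_optimal es v R X)"

lemma coreD:
  assumes "core D es v R X"
  shows "D \<subseteq> V" "set es = {e \<in> D. {e} \<in> M}" "\<And>e. e \<in> set es \<Longrightarrow> v e = f {e}"
    "R \<in> M" "R \<subseteq> D" "\<And>e. e \<in> D \<Longrightarrow> insert e R \<in> M \<Longrightarrow> e \<in> R"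
    "X \<in> lift_matroid l M" "fst ` X \<subseteq> set es" "\<And>e. e \<in> set es \<Longrightarrow> a * f {e} \<le> 2 * g X"
  using assms unfolding core_def by auto

lemma core_card_le:
  assumes c: "core D es v R X" and T: "T \<in> M" "T \<subseteq> D"
  shows "card T \<le> card R"
proof (rule ccontr)
  assume "\<not> card T \<le> card R"
  then obtain e where "e \<in> T - R" "insert e R \<in> M"
    using matroidD(6)[OF mat coreD(4)[OF c] T(1)] by auto
  then show False using coreD(6)[OF c, of e] T(2) by auto
qed

lemma core_independent_subset:
  assumes c: "core D es v R X" and T: "T \<in> M" "T \<subseteq> D"
  shows "T \<subseteq> set es"
  using coreD(2)[OF c] T matroidD(4)[OF mat T(1)] by auto

lemma value_le_sum:
  assumes "finite A" "A \<subseteq> V" "B \<subseteq> V"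
  shows "f (B \<union> A) \<le> f B + (\<Sum>x\<in>A. f {x})"
proof -
  have "f (insert x B) - f B \<le> f {x}" if "x \<in> A" for x
    using diminishing_returns[OF nms, of "{}" B x] assms that nmsD(1)[OF nms, of "{}"] by auto
  then have "(\<Sum>x\<in>A. f (insert x B) - f B) \<le> (\<Sum>x\<in>A. f {x})" by (rule sum_mono)
  with gain_le_sum_gains[OF nms assms] show ?thesis by simp
qed

lemma g_nonneg: "X \<in> lift_matroid l M \<Longrightarrow> 0 \<le> g X"
  using nmsD(1)[OF nms_potential[OF nms] lift_matroid_subset[OF mat]] .

lemma g_le_mult_value: "X \<in> lift_matroid l M \<Longrightarrow> g X \<le> (real l)\<^sup>2 * a * f (fst ` X)"
  using potential_le[OF mat nms l] by (simp add: a_def)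

lemma moves_lift: "X \<in> lift_matroid l M \<Longrightarrow> Z \<in> moves l X e \<Longrightarrow> fst ` Z \<in> M \<Longrightarrow> Z \<in> lift_matroid l M"
  by (auto simp: moves_def lift_matroid_def simp del: inj_on_insert)

lemma core_move:
  assumes c: "core D es v R X" and Z: "Z \<in> moves l X e" "e \<in> set es" "fst ` Z \<in> M" "g X \<le> g Z"
  shows "core D es v R Z"
proof -
  have "Z \<in> lift_matroid l M" using moves_lift[OF coreD(7)[OF c] Z(1,3)] .
  moreover have "fst ` Z \<subseteq> set es" using fst_moves[OF Z(1)] Z(2) coreD(8)[OF c] by auto
  ultimately show ?thesis using c Z(4) unfolding core_def by force
qed

text \<open>The value of a set is at most the sum of its singleton values, hence at most the rank
  times the best of them. This ceiling of the potential limits both the fuel of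
  \<open>improve\<close> and the levels of an element.\<close>

lemma core_g_le:
  assumes c: "core D es v R X" and "es \<noteq> []" and Y: "Y \<in> lift_matroid l M" "fst ` Y \<subseteq> set es"
  shows "g Y \<le> (real l)\<^sup>2 * a * (real (card R) * v (best v es))"
proof -
  let ?b = "best v es"
  note b = best[OF assms(2), where v = v]
  have fY: "fst ` Y \<in> M" using Y(1) by (simp add: lift_matroid_def)
  have YD: "fst ` Y \<subseteq> D" "D \<subseteq> V" using Y(2) coreD(1,2)[OF c] by auto
  have bD: "{?b} \<in> M" "?b \<in> D" "v ?b = f {?b}" using b(1) coreD(2,3)[OF c] by auto
  have 1: "1 \<le> card R" using core_card_le[OF c, of "{?b}"] bD by simp
  have b0: "0 \<le> v ?b" using nmsD(1)[OF nms, of "{?b}"] bD YD by auto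
  have "f (fst ` Y) \<le> real (card R) * v ?b"
  proof (cases "Y = {}")
    case True
    have "f {} \<le> f {?b}" by (rule nmsD(2)[OF nms]) (use bD YD in auto)
    also have "\<dots> \<le> real (card R) * v ?b" using 1 b0 bD mult_right_mono[of 1 "real (card R)" "v ?b"] by simp
    finally show ?thesis using True by simp
  next
    case False
    then obtain y where y: "y \<in> fst ` Y" by auto
    have fin: "finite (fst ` Y)" using matroidD(5)[OF mat fY] .
    \<comment> \<open>Starting the sum from a member \<open>y\<close> rather than from the empty set
      avoids the term \<open>f {}\<close>, which may be positive.\<close>
    have "f ({y} \<union> (fst ` Y - {y})) \<le> f {y} + (\<Sum>x\<in>fst ` Y - {y}. f {x})"
      by (rule value_le_sum) (use fin YD y in auto)
    also have "{y} \<union> (fst ` Y - {y}) = fst ` Y" using y by auto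
    also have "f {y} + (\<Sum>x\<in>fst ` Y - {y}. f {x}) = (\<Sum>x\<in>fst ` Y. f {x})"
      using sum.remove[OF fin y, of "\<lambda>x. f {x}"] by simp
    also have "\<dots> \<le> (\<Sum>x\<in>fst ` Y. v ?b)"
      using Y(2) b(2) coreD(3)[OF c] by (intro sum_mono) force
    also have "\<dots> = real (card (fst ` Y)) * v ?b" by simp
    also have "\<dots> \<le> real (card R) * v ?b"
      using core_card_le[OF c fY YD(1)] b0 by (intro mult_right_mono) auto
    finally show ?thesis .
  qed
  then have "(real l)\<^sup>2 * a * f (fst ` Y) \<le> (real l)\<^sup>2 * a * (real (card R) * v ?b)"
    using a_ge_1 by (intro mult_left_mono) auto
  with g_le_mult_value[OF Y(1)] show ?thesis by simp
qed

lemma settled_value: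
  assumes c: "core D es v R X" and s: "settled D es v R X" and T: "T \<in> M" "T \<subseteq> D"
    and Tmax: "\<And>T'. T' \<in> M \<Longrightarrow> T' \<subseteq> D \<Longrightarrow> f T' \<le> f T"
  shows "(1 - 1 / exp 1 - 3 / real l) * f T \<le> f (fst ` X)"
proof -
  note [simp] = l
  have TV: "T \<subseteq> V" using matroidD(3)[OF mat T(1)] .
  have fT: "0 \<le> f T" using nmsD(1)[OF nms TV] .
  have BM: "fst ` X \<in> M" using coreD(7)[OF c] by (simp add: lift_matroid_def)
  have fB: "0 \<le> f (fst ` X)" using nmsD(1)[OF nms matroidD(3)[OF mat BM]] .
  have BD: "fst ` X \<subseteq> D" using coreD(2,8)[OF c] by auto
  show ?thesis
  proof (cases "card R \<le> 1")
    case True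
    have "0 \<le> 1 / exp 1 + 3 / real l" by simp
    then have "1 - 1 / exp 1 - 3 / real l \<le> 1" by linarith
    then have "(1 - 1 / exp 1 - 3 / real l) * f T \<le> 1 * f T" by (intro mult_right_mono fT)
    then show ?thesis using s T True by (force simp: settled_def)
  next
    case False
    let ?r = "real (card R)"
    \<comment> \<open>The exchange argument applies to the alive part of \<open>T\<close> only. Each
      of the at most \<open>card R\<close> dropped elements is beaten by a factor above
      \<open>l * card R\<close> by some singleton, itself worth at most \<open>f T\<close>.\<close>
    define A where "A = T \<inter> set (alive l (card R) v es)"
    have AM: "A \<in> M" using matroidD(4)[OF mat T(1)] by (auto simp: A_def)
    have r: "0 < ?r" using False by simp
    have drop: "f {x} \<le> f T / (real l * ?r)" if x: "x \<in> T - A" for x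
    proof -
      have "x \<in> set es" "x \<notin> set (alive l (card R) v es)"
        using x core_independent_subset[OF c T] by (auto simp: A_def)
      then obtain b where b: "b \<in> set es" "\<not> v b \<le> real l * ?r * v x" unfolding set_alive by blast
      have "f {b} \<le> f T" using b(1) coreD(2)[OF c] by (intro Tmax) auto
      then have "real l * ?r * f {x} \<le> f T"
        using b \<open>x \<in> set es\<close> coreD(3)[OF c, of b] coreD(3)[OF c, of x] by simp
      then show ?thesis using r by (simp add: le_divide_eq mult.commute)
    qed
    have "f (A \<union> (T - A)) \<le> f A + (\<Sum>x\<in>T - A. f {x})"
      by (rule value_le_sum) (use TV matroidD(5)[OF mat T(1)] in \<open>auto simp: A_def\<close>)
    also have "A \<union> (T - A) = T" by (auto simp: A_def)
    also have "(\<Sum>x\<in>T - A. f {x}) \<le> (\<Sum>x\<in>T - A. f T / (real l * ?r))"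
      by (intro sum_mono drop)
    also have "\<dots> = real (card (T - A)) * (f T / (real l * ?r))" by simp
    also have "\<dots> \<le> ?r * (f T / (real l * ?r))"
    proof (rule mult_right_mono)
      have "card (T - A) \<le> card T" using matroidD(5)[OF mat T(1)] by (intro card_mono) auto
      then show "real (card (T - A)) \<le> ?r" using core_card_le[OF c T] by simp
    qed (use fT in simp)
    also have "\<dots> = f T / real l" using r by simp
    finally have fA: "f T - f T / real l \<le> f A" by simp
    let ?q = "1 + 1 / real l"
    define \<eta> where "\<eta> = g X / ((real l)\<^sup>2 * ?r)"
    have "(?q ^ l - 1) * f A \<le> ?q ^ l * f (fst ` X) + real (card A) * \<eta> / real l"
    proof (rule local_optimum_value[OF mat nms l coreD(7)[OF c] AM])
      show "0 \<le> \<eta>" using g_nonneg[OF coreD(7)[OF c]] by (simp add: \<eta>_def)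
      fix x j Y assume h: "x \<in> A" "j < l" "Y \<subseteq> X" "card Y \<le> 1" "insert (x, j) (X - Y) \<in> lift_matroid l M"
      then have "insert (x, j) (X - Y) \<in> moves l X x" unfolding moves_def lift_matroid_def by blast
      moreover have "fst ` insert (x, j) (X - Y) \<in> M" using h(5) by (simp add: lift_matroid_def)
      moreover have "x \<in> set (alive l (card R) v es)" using h(1) by (simp add: A_def)
      ultimately have "g (insert (x, j) (X - Y)) \<le> improvement_factor l (card R) * g X"
        using s False unfolding settled_def locally_optimal_def by simp
      also have "\<dots> = g X + \<eta>" by (simp add: improvement_factor_def \<eta>_def algebra_simps)
      finally show "g (insert (x, j) (X - Y)) \<le> g X + \<eta>" .
    qed
    also have "real (card A) * \<eta> / real l \<le> ?q ^ l * (f (fst ` X) / real l)"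
    proof -
      have "real (card A) * \<eta> \<le> ?r * \<eta>"
        using core_card_le[OF c AM] T g_nonneg[OF coreD(7)[OF c]]
        by (intro mult_right_mono) (auto simp: A_def \<eta>_def)
      also have "\<dots> = g X / (real l)\<^sup>2" using r by (simp add: \<eta>_def)
      also have "\<dots> \<le> a * f (fst ` X)"
        using g_le_mult_value[OF coreD(7)[OF c]] by (simp add: divide_le_eq mult_ac)
      also have "\<dots> \<le> ?q ^ l * f (fst ` X)"
        unfolding a_def by (intro mult_right_mono fB power_increasing) auto
      finally show ?thesis by (simp add: divide_right_mono)
    qed
    finally have "(?q ^ l - 1) * f A \<le> ?q ^ l * (f (fst ` X) + f (fst ` X) / real l)"
      by (simp add: distrib_left)
    moreover have Q: "0 < ?q ^ l" by (simp add: add_pos_nonneg)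
    moreover have "?q ^ l * ((1 - 1 / ?q ^ l) * f A) = (?q ^ l - 1) * f A"
      using less_imp_neq[OF Q] by (simp add: right_diff_distrib left_diff_distrib del: power_divide)
    ultimately have 1: "(1 - 1 / ?q ^ l) * f A \<le> f (fst ` X) + f (fst ` X) / real l"
      by (metis mult_le_cancel_left_pos)
    have "1 \<le> ?q ^ l" by (simp add: one_le_power)
    then have "1 / ?q ^ l \<le> 1" using Q by (subst divide_le_eq_1_pos)
    then have q1: "0 \<le> 1 - 1 / ?q ^ l" "1 - 1 / ?q ^ l \<le> 1" using Q by simp_all
    have "(1 - 1 / ?q ^ l) * (f T - f T / real l) \<le> (1 - 1 / ?q ^ l) * f A"
      by (intro mult_left_mono fA q1)
    with 1 have 2: "(1 - 1 / ?q ^ l) * (f T - f T / real l) \<le> f (fst ` X) + f (fst ` X) / real l" by simp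
    \<comment> \<open>Here \<open>x\<close> is \<open>f T\<close> and \<open>t\<close> is
      \<open>f T / l\<close>. One \<open>t\<close> each is lost for the dropped elements, for the
      slack \<open>s\<close> of the improvements, and for bounding \<open>p\<close>, which is (1 +
      1/l)^-l, by 1/e + 1/l.\<close>
    have combine: "x - x * E - 3 * t \<le> B"
      if "(1 - p) * (x - t) \<le> B + s" "s \<le> t" "(1 - p) * t \<le> 1 * t" "x * p \<le> x * (E + d)" "x * d = t"
      for p t E x s B d :: real
      using that by (simp add: algebra_simps)
    have "f T - f T * (1 / exp 1) - 3 * (f T / real l) \<le> f (fst ` X)"
    proof (rule combine[OF 2])
      show "f (fst ` X) / real l \<le> f T / real l" by (intro divide_right_mono Tmax BM BD) simp
      show "(1 - 1 / ?q ^ l) * (f T / real l) \<le> 1 * (f T / real l)"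
        using fT by (intro mult_right_mono q1) simp
      show "f T * (1 / ?q ^ l) \<le> f T * (1 / exp 1 + 1 / real l)"
        by (intro mult_left_mono inverse_power_le_exp fT l)
    qed simp
    then show ?thesis by (simp add: left_diff_distrib)
  qed
qed

subsection \<open>Number of queries\<close>

text \<open>An upper bound for the number of improvements of a solution of potential \<open>\<gamma>\<close> that can still
  happen before \<open>e\<close> ceases to be alive.\<close>

definition levels :: "'a \<Rightarrow> real \<Rightarrow> real" where
  "levels e \<gamma> = max 0 (log (improvement_factor l k) (real l ^ 3 * (real k)\<^sup>2 * a * f {e} / \<gamma>))"

text \<open>The logarithm of \<open>levels\<close> at \<gamma> = \<open>a * f {e} / 2\<close>, the
  least potential that \<open>core\<close> permits.\<close>

definition max_levels :: real where
  "max_levels = log (improvement_factor l k) (2 * real l ^ 3 * (real k)\<^sup>2)"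

text \<open>Trying all moves of one element: \<open>l\<close> colours, at most \<open>k + 1\<close>
  choices of what to remove, and the queries of \<open>search\<close> for each.\<close>

definition scan_cost :: real where
  "scan_cost = real l * (real k + 1) * (1 + 2 * 2 ^ l)"

text \<open>The credit, counted in scans of single elements: one for each growth of the rank still
  possible and one for each level.\<close>

definition pending :: "'a list \<Rightarrow> 'a set \<Rightarrow> ('a \<times> nat) set \<Rightarrow> real" where
  "pending es R X = (\<Sum>e\<leftarrow>es. real k - real (card R) + levels e (g X))"

lemma scan_cost_nonneg: "0 \<le> scan_cost"
  by (simp add: scan_cost_def)

lemma levels_nonneg: "0 \<le> levels e \<gamma>"
  by (simp add: levels_def)

text \<open>Relies on the convention \<open>ln 0 = 0\<close>.\<close>

lemma levels_0: "f {e} = 0 \<Longrightarrow> levels e \<gamma> = 0"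
  by (simp add: levels_def log_def)

lemma level_const_pos: "0 < k \<Longrightarrow> 0 < real l ^ 3 * (real k)\<^sup>2 * a"
  using l a_ge_1 by simp

lemma levels_antimono:
  assumes "0 < k" "0 \<le> f {e}" "a * f {e} \<le> 2 * \<gamma>" "\<gamma> \<le> \<gamma>'"
  shows "levels e \<gamma>' \<le> levels e \<gamma>"
proof (cases "f {e} = 0")
  case False
  then have "0 < f {e}" using assms(2) by simp
  then have "0 < a * f {e}" using a_ge_1 by simp
  then have \<gamma>: "0 < \<gamma>" using assms(3) by simp
  have c: "0 < real l ^ 3 * (real k)\<^sup>2 * a * f {e}"
    using level_const_pos[OF assms(1)] \<open>0 < f {e}\<close> by simp
  have "log (improvement_factor l k) (real l ^ 3 * (real k)\<^sup>2 * a * f {e} / \<gamma>') \<le>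
      log (improvement_factor l k) (real l ^ 3 * (real k)\<^sup>2 * a * f {e} / \<gamma>)"
  proof (rule log_mono[OF improvement_factor_gt_1[OF l assms(1)]])
    show "0 < real l ^ 3 * (real k)\<^sup>2 * a * f {e} / \<gamma>'"
      using \<gamma> assms(4) by (intro divide_pos_pos[OF c]) simp
    show "real l ^ 3 * (real k)\<^sup>2 * a * f {e} / \<gamma>' \<le> real l ^ 3 * (real k)\<^sup>2 * a * f {e} / \<gamma>"
      using \<gamma> assms(4) by (intro divide_left_mono less_imp_le[OF c]) auto
  qed
  then show ?thesis by (simp add: levels_def)
qed (simp add: levels_0)

lemma max_levels_nonneg: "0 \<le> max_levels"
proof (cases "k = 0")
  case True
  \<comment> \<open>The base is 1 here, and the logarithm is 0 through division by zero.\<close>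
  then show ?thesis by (simp add: max_levels_def improvement_factor_def log_def)
next
  case False
  then have "1 \<le> real l ^ 3 * (real k)\<^sup>2"
    using l mult_mono[of 1 "real l ^ 3" 1 "(real k)\<^sup>2"] by (simp add: one_le_power)
  then show ?thesis
    unfolding max_levels_def using improvement_factor_gt_1[OF l] False by (simp add: zero_le_log_cancel_iff)
qed

lemma levels_le_max_levels:
  assumes "0 < k" "0 \<le> f {e}" "a * f {e} \<le> 2 * \<gamma>"
  shows "levels e \<gamma> \<le> max_levels"
proof (cases "f {e} = 0")
  case True
  then show ?thesis using max_levels_nonneg by (simp add: levels_0)
next
  case False
  then have fe: "0 < f {e}" using assms(2) by simp
  then have "0 < a * f {e}" using a_ge_1 by simp
  then have \<gamma>: "0 < \<gamma>" using assms(3) by simp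
  have c: "0 < real l ^ 3 * (real k)\<^sup>2 * a * f {e}"
    using level_const_pos[OF assms(1)] fe by simp
  have "real l ^ 3 * (real k)\<^sup>2 * (a * f {e}) \<le> real l ^ 3 * (real k)\<^sup>2 * (2 * \<gamma>)"
    using assms(3) by (intro mult_left_mono) auto
  then have "real l ^ 3 * (real k)\<^sup>2 * a * f {e} / \<gamma> \<le> 2 * real l ^ 3 * (real k)\<^sup>2"
    using \<gamma> by (simp add: divide_le_eq mult_ac)
  then have "log (improvement_factor l k) (real l ^ 3 * (real k)\<^sup>2 * a * f {e} / \<gamma>) \<le> max_levels"
    unfolding max_levels_def
    by (rule log_mono[OF improvement_factor_gt_1[OF l assms(1)] divide_pos_pos[OF c \<gamma>]])
  then show ?thesis using max_levels_nonneg by (simp add: levels_def)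
qed

lemma core_value_nonneg:
  assumes "core D es v R X" "e \<in> set es"
  shows "0 \<le> f {e}"
  using coreD(1,2)[OF assms(1)] assms(2) by (intro nmsD(1)[OF nms]) auto

lemma core_rank_pos:
  assumes "core D es v R X" "es \<noteq> []"
  shows "0 < card R" "card R \<le> k" "0 < k"
proof -
  obtain e where "e \<in> set es" using assms(2) by (cases es) auto
  then have "card {e} \<le> card R" using coreD(2)[OF assms(1)] by (intro core_card_le[OF assms(1)]) auto
  then show "0 < card R" "card R \<le> k" "0 < k"
    using card_le_k[OF coreD(4)[OF assms(1)]] by auto
qed

text \<open>As \<open>e\<close> is alive, the best singleton value is at most
  \<open>l * card R * f {e}\<close>, so the ceiling of the potential is at most the numerator in
  \<open>levels\<close>. The new logarithm is therefore nonnegative, the cut-off at 0 does not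
  interfere, and growth of the potential by the base costs a full level.\<close>

lemma levels_decrease:
  assumes c: "core D es v R X" and e: "e \<in> set (alive l (card R) v es)"
    and low: "a * f {e} \<le> 2 * \<gamma>" and up: "\<gamma>' \<le> (real l)\<^sup>2 * a * (real (card R) * v (best v es))"
    and inc: "improvement_factor l k * \<gamma> \<le> \<gamma>'" "\<gamma> < \<gamma>'"
  shows "levels e \<gamma>' + 1 \<le> levels e \<gamma>"
proof -
  let ?r = "real (card R)" and ?K = "improvement_factor l k"
  let ?c = "real l ^ 3 * (real k)\<^sup>2 * a * f {e}"
  have e': "e \<in> set es" "es \<noteq> []" using e by (auto simp: alive_def)
  note rk = core_rank_pos[OF c e'(2)]
  have K: "1 < ?K" using improvement_factor_gt_1[OF l rk(3)] .
  have fe: "0 \<le> f {e}" using core_value_nonneg[OF c e'(1)] .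
  have vb: "v (best v es) \<le> real l * ?r * f {e}"
    using e best(1)[OF e'(2), of v] coreD(3)[OF c e'(1)] unfolding set_alive by auto
  have "0 \<le> a * f {e}" using fe a_ge_1 by simp
  then have \<gamma>0: "0 \<le> \<gamma>" using low by simp
  have \<gamma>'0: "0 < \<gamma>'" using \<gamma>0 inc(2) by simp
  have "\<gamma>' \<le> (real l)\<^sup>2 * a * (?r * (real l * ?r * f {e}))"
    using order_trans[OF up] vb a_ge_1 by (simp add: mult_left_mono)
  also have "\<dots> = real l ^ 3 * a * f {e} * ?r\<^sup>2" by (simp add: power2_eq_square power3_eq_cube)
  also have "\<dots> \<le> real l ^ 3 * a * f {e} * (real k)\<^sup>2"
    using rk fe a_ge_1 by (intro mult_left_mono power_mono) auto
  finally have \<gamma>'c: "\<gamma>' \<le> ?c" by (simp add: mult_ac)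
  then have c0: "0 < ?c" using \<gamma>'0 by linarith
  then have "0 < f {e}" using fe by (cases "f {e} = 0") auto
  then have "0 < a * f {e}" using a_ge_1 by simp
  then have \<gamma>: "0 < \<gamma>" using low by simp
  have 1: "0 \<le> log ?K (?c / \<gamma>')"
    using K \<gamma>'c \<gamma>'0 c0 by (subst zero_le_log_cancel_iff) auto
  have "log ?K (?c / \<gamma>') + 1 = log ?K (?c / \<gamma>' * ?K)"
    using K c0 \<gamma>'0 by (subst log_mult) auto
  also have "\<dots> \<le> log ?K (?c / \<gamma>)"
  proof (rule log_mono[OF K])
    show "0 < ?c / \<gamma>' * ?K" 
      using K by (intro mult_pos_pos[OF divide_pos_pos[OF c0 \<gamma>'0]]) simp
    have "?c * (?K * \<gamma>) \<le> ?c * \<gamma>'" using c0 inc(1) by (intro mult_left_mono) auto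
    then show "?c / \<gamma>' * ?K \<le> ?c / \<gamma>" using \<gamma> \<gamma>'0 by (simp add: field_simps)
  qed
  finally show ?thesis using 1 unfolding levels_def by linarith
qed

section \<open>Amortised cost of the local search and of an insertion\<close>

lemma length_all_moves_le:
  assumes "X \<in> lift_matroid l M"
  shows "real (length (all_moves l X es) * (1 + 2 * 2 ^ l)) \<le> scan_cost * real (length es)"
proof -
  have "card X = card (fst ` X)" using assms by (simp add: lift_matroid_def card_image)
  then have "card X \<le> k" using card_le_k assms by (simp add: lift_matroid_def)
  then have "length es * (l * (card X + 1)) \<le> length es * (l * (k + 1))" by simp
  then have "length (all_moves l X es) * (1 + 2 * 2 ^ l) \<le> length es * (l * (k + 1)) * (1 + 2 * 2 ^ l)"
    by (intro mult_right_mono le_trans[OF length_all_moves[OF lift_matroid_finite[OF mat assms]]]) auto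
  then have "real (length (all_moves l X es) * (1 + 2 * 2 ^ l)) \<le> real (length es * (l * (k + 1)) * (1 + 2 * 2 ^ l))"
    by (simp only: of_nat_le_iff)
  also have "\<dots> = scan_cost * real (length es)" by (simp add: scan_cost_def algebra_simps)
  finally show ?thesis .
qed

text \<open>A successful scan is paid for by the level that every alive element loses; only the
  last, unsuccessful one is charged through \<open>of_bool\<close>. The condition on
  \<open>n\<close> says that \<open>n\<close> improvements would lift the potential to its
  ceiling.\<close>

lemma runs_improve:
  fixes D es v R
  defines "W \<equiv> alive l (card R) v es" and "\<kappa> \<equiv> improvement_factor l (card R)"
  assumes "core D es v R X" and ne: "es \<noteq> []"
    and "(real l)\<^sup>2 * a * (real (card R) * v (best v es)) \<le> g X * \<kappa> ^ n"
  shows "\<exists>X' ps. runs f M (improve l \<kappa> W n X (\<lambda>X. Return (h X))) (h X') ps \<and>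
      core D es v R X' \<and> locally_optimal es v R X' \<and> (\<forall>Q\<in>set ps. Q \<subseteq> D) \<and>
      real (length ps) + scan_cost * (\<Sum>e\<leftarrow>es. levels e (g X')) \<le>
        scan_cost * (\<Sum>e\<leftarrow>es. of_bool (e \<in> set W) + levels e (g X))"
  using assms(3,5)
proof (induction n arbitrary: X)
  \<comment> \<open>Out of fuel, the potential has reached its ceiling, so the solution is locally
    optimal without another scan.\<close>
  case (0 X)
  note c = 0(1)
  note rk = core_rank_pos[OF c ne]
  have "g Z \<le> \<kappa> * g X" if "e \<in> set W" "Z \<in> moves l X e" "fst ` Z \<in> M" for e Z
  proof -
    have "Z \<in> lift_matroid l M" using moves_lift[OF coreD(7)[OF c] that(2,3)] .
    moreover have "fst ` Z \<subseteq> set es" using fst_moves[OF that(2)] coreD(8)[OF c] that(1) by (auto simp: W_def alive_def)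
    ultimately have "g Z \<le> g X" using core_g_le[OF c ne] 0(2) by fastforce
    also have "\<dots> \<le> \<kappa> * g X"
      using mult_right_mono[of 1 \<kappa> "g X"] improvement_factor_gt_1[OF l rk(1)] g_nonneg[OF coreD(7)[OF c]]
      by (simp add: \<kappa>_def)
    finally show ?thesis .
  qed
  then have "locally_optimal es v R X" by (simp add: locally_optimal_def W_def \<kappa>_def)
  moreover have "scan_cost * (\<Sum>e\<leftarrow>es. levels e (g X)) \<le> scan_cost * (\<Sum>e\<leftarrow>es. of_bool (e \<in> set W) + levels e (g X))"
    by (intro mult_left_mono scan_cost_nonneg sum_list_mono) simp
  ultimately show ?case using c by (intro exI[of _ X] exI[of _ "[]"]) (simp add: runs_Return)
next
  case (Suc n X)
  note c = Suc.prems(1)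
  note rk = core_rank_pos[OF c ne]
  let ?Zs = "all_moves l X W"
  let ?c = "\<lambda>res. case res of None \<Rightarrow> Return (h X) | Some Z \<Rightarrow> improve l \<kappa> W n Z (\<lambda>X. Return (h X))"
  have fin: "finite X" using lift_matroid_finite[OF mat coreD(7)[OF c]] .
  have WE: "set W \<subseteq> set es" by (auto simp: W_def alive_def)
  have esD: "set es \<subseteq> D" using coreD(2)[OF c] by auto
  have ZsD: "\<forall>Z\<in>set ?Zs. fst ` Z \<subseteq> D"
  proof
    fix Z assume "Z \<in> set ?Zs"
    then obtain e where e: "e \<in> set W" "Z \<in> moves l X e" unfolding set_all_moves[OF fin] by auto
    show "fst ` Z \<subseteq> D"
      by (rule order_trans[OF fst_moves[OF e(2)]]) (use coreD(8)[OF c] e(1) WE esD in auto)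
  qed
  have XD: "fst ` X \<subseteq> D" using coreD(8)[OF c] esD by auto
  have lenW: "real (length W) = (\<Sum>e\<leftarrow>es. of_bool (e \<in> set W))"
    unfolding W_def alive_def sum_list_of_bool ..
  note cost = length_all_moves_le[OF coreD(7)[OF c], of W]
  show ?case
  proof (cases "find (\<lambda>Z. fst ` Z \<in> M \<and> \<kappa> * g X < g Z) ?Zs")
    case None
    have "runs f M (?c None) (h X) []" by (simp add: runs_Return)
    then have "runs f M (?c (find (\<lambda>Z. fst ` Z \<in> M \<and> \<kappa> * g X < g Z) ?Zs)) (h X) []"
      unfolding None .
    from runs_search[where k = ?c, OF this XD ZsD] obtain ps where
      ps: "runs f M (search l \<kappa> X ?Zs ?c) (h X) (ps @ [])" "length ps \<le> length ?Zs * (1 + 2 * 2 ^ l)"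
        "\<forall>Q\<in>set ps. Q \<subseteq> D" by blast
    have "locally_optimal es v R X"
      using None unfolding locally_optimal_def find_None_iff set_all_moves[OF fin] W_def[symmetric] \<kappa>_def[symmetric]
      by (auto simp: not_less)
    moreover have "real (length ps) \<le> scan_cost * real (length W)"
      using cost ps(2) by (meson of_nat_le_iff order_trans)
    ultimately show ?thesis using c ps lenW
      by (intro exI[of _ X] exI[of _ ps]) (simp add: sum_list_addf distrib_left)
  next
    case (Some Z)
    then have Z: "Z \<in> set ?Zs" "fst ` Z \<in> M" "\<kappa> * g X < g Z" by (auto simp: find_Some_iff in_set_conv_nth)
    then obtain e where e: "e \<in> set W" "Z \<in> moves l X e" unfolding set_all_moves[OF fin] by auto
    have \<kappa>: "1 < \<kappa>" "improvement_factor l k \<le> \<kappa>"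
      using improvement_factor_gt_1[OF l rk(1)] improvement_factor_antimono[OF l rk(1,2)] by (simp_all add: \<kappa>_def)
    have gX: "0 \<le> g X" using g_nonneg[OF coreD(7)[OF c]] .
    have gXZ: "g X < g Z" using Z(3) \<kappa>(1) gX mult_right_mono[of 1 \<kappa> "g X"] by simp
    have cZ: "core D es v R Z" using core_move[OF c e(2) _ Z(2)] gXZ e(1) WE by auto
    have "g X * \<kappa> ^ Suc n \<le> g Z * \<kappa> ^ n"
      using Z(3) \<kappa>(1) mult_right_mono[of "\<kappa> * g X" "g Z" "\<kappa> ^ n"] by (simp add: mult_ac)
    with Suc.prems(2) have "(real l)\<^sup>2 * a * (real (card R) * v (best v es)) \<le> g Z * \<kappa> ^ n" by linarith
    from Suc.IH[OF cZ this] obtain X' ps2 where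
      ps2: "runs f M (improve l \<kappa> W n Z (\<lambda>X. Return (h X))) (h X') ps2"
        "core D es v R X'" "locally_optimal es v R X'" "\<forall>Q\<in>set ps2. Q \<subseteq> D"
        "real (length ps2) + scan_cost * (\<Sum>e\<leftarrow>es. levels e (g X')) \<le>
          scan_cost * (\<Sum>e\<leftarrow>es. of_bool (e \<in> set W) + levels e (g Z))" by blast
    have "runs f M (?c (find (\<lambda>Z. fst ` Z \<in> M \<and> \<kappa> * g X < g Z) ?Zs)) (h X') ps2"
      unfolding Some using ps2(1) by simp
    from runs_search[where k = ?c, OF this XD ZsD] obtain ps where
      ps: "runs f M (search l \<kappa> X ?Zs ?c) (h X') (ps @ ps2)" "length ps \<le> length ?Zs * (1 + 2 * 2 ^ l)"
        "\<forall>Q\<in>set ps. Q \<subseteq> D" by blast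
    have "(\<Sum>e\<leftarrow>es. of_bool (e \<in> set W) + levels e (g Z)) \<le> (\<Sum>e\<leftarrow>es. levels e (g X))"
    proof (rule sum_list_mono)
      fix x assume x: "x \<in> set es"
      show "of_bool (x \<in> set W) + levels x (g Z) \<le> levels x (g X)"
      proof (cases "x \<in> set W")
        case True
        have "improvement_factor l k * g X \<le> g Z" using mult_right_mono[OF \<kappa>(2) gX] Z(3) by linarith
        from levels_decrease[OF c True[unfolded W_def] coreD(9)[OF c x] core_g_le[OF cZ ne coreD(7,8)[OF cZ]] this gXZ]
        show ?thesis using True by simp
      next
        case False
        then show ?thesis
          using levels_antimono[OF rk(3) core_value_nonneg[OF c x] coreD(9)[OF c x]] gXZ by simp
      qed
    qed
    then have "scan_cost * (\<Sum>e\<leftarrow>es. of_bool (e \<in> set W) + levels e (g Z)) \<le> scan_cost * (\<Sum>e\<leftarrow>es. levels e (g X))"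
      by (intro mult_left_mono scan_cost_nonneg)
    moreover have "real (length ps) \<le> scan_cost * real (length W)"
      using cost ps(2) by (meson of_nat_le_iff order_trans)
    ultimately have "real (length (ps @ ps2)) + scan_cost * (\<Sum>e\<leftarrow>es. levels e (g X')) \<le>
        scan_cost * (\<Sum>e\<leftarrow>es. of_bool (e \<in> set W) + levels e (g X))"
      using ps2(5) lenW by (simp add: sum_list_addf distrib_left)
    then show ?thesis using ps ps2(2-4) by (intro exI[of _ X'] exI[of _ "ps @ ps2"]) auto
  qed
qed

lemma runs_improve_all:
  assumes c: "core D es v R X" and ne: "es \<noteq> []"
  shows "\<exists>X' ps. runs f M (improve_all l es v R X) (solution (es, v, R, X'), (es, v, R, X')) ps \<and>
      core D es v R X' \<and> locally_optimal es v R X' \<and> (\<forall>Q\<in>set ps. Q \<subseteq> D) \<and>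
      real (length ps) + scan_cost * (\<Sum>e\<leftarrow>es. levels e (g X')) \<le>
        scan_cost * (\<Sum>e\<leftarrow>es. of_bool (e \<in> set (alive l (card R) v es)) + levels e (g X))"
  unfolding improve_all_def
proof (rule runs_improve[OF c ne])
  let ?r = "real (card R)" and ?n = "2 * l ^ 4 * (card R)\<^sup>2"
  note rk = core_rank_pos[OF c ne]
  have "1 + real ?n * (1 / ((real l)\<^sup>2 * ?r)) \<le> improvement_factor l (card R) ^ ?n"
    unfolding improvement_factor_def by (rule Bernoulli_inequality) (simp add: order_trans[of _ 0])
  also have "real ?n * (1 / ((real l)\<^sup>2 * ?r)) = 2 * (real l)\<^sup>2 * ?r"
    using l rk by (simp add: field_simps power2_eq_square power4_eq_xxxx)
  finally have "g X * (2 * (real l)\<^sup>2 * ?r) \<le> g X * improvement_factor l (card R) ^ ?n"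
    using g_nonneg[OF coreD(7)[OF c]] by (intro mult_left_mono) auto
  moreover have "a * v (best v es) \<le> 2 * g X"
    using coreD(9)[OF c best(1)[OF ne]] coreD(3)[OF c best(1)[OF ne]] by simp
  then have "((real l)\<^sup>2 * ?r) * (a * v (best v es)) \<le> ((real l)\<^sup>2 * ?r) * (2 * g X)"
    by (intro mult_left_mono) auto
  ultimately show "(real l)\<^sup>2 * a * (?r * v (best v es)) \<le> g X * improvement_factor l (card R) ^ ?n"
    by (simp add: mult_ac)
qed

text \<open>\<open>2 ^ l\<close> queries evaluate the current potential, one scan covers the moves
  of \<open>e\<close>, and \<open>k + max_levels\<close> is the credit that \<open>e\<close>
  receives. Older elements pay for their rescans themselves: with a level if the potential has
  grown, or with one unit of \<open>k - card R\<close> if the rank has.\<close>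

lemma runs_update:
  assumes c: "core D es v R X" and s: "settled D es v R X" and eV: "e \<in> V" and eM: "{e} \<in> M"
  defines "D' \<equiv> insert e D" and "es' \<equiv> e # es" and "v' \<equiv> v(e := f {e})"
    and "R' \<equiv> if insert e R \<in> M then insert e R else R"
  shows "\<exists>X' qs. runs f M (update l es' v' R' (insert e R \<in> M \<and> e \<notin> R) X e)
        (solution (es', v', R', X'), (es', v', R', X')) qs \<and>
      core D' es' v' R' X' \<and> settled D' es' v' R' X' \<and> (\<forall>Q\<in>set qs. Q \<subseteq> D') \<and>
      (card R' \<le> 1 \<longrightarrow> qs = []) \<and>
      (1 < card R' \<longrightarrow> real (length qs) + scan_cost * pending es' R' X' \<le>
          2 ^ l + scan_cost * (1 + real k + max_levels) + scan_cost * pending es R X)"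
proof -
  let ?e0 = "{(e, 0)}" and ?b = "best v' es'"
  have ne: "es' \<noteq> []" by (simp add: es'_def)
  have v': "v' x = f {x}" if "x \<in> set es'" for x
    using that coreD(3)[OF c] by (auto simp: v'_def es'_def)
  have set_es': "set es' = {x \<in> D'. {x} \<in> M}" using coreD(2)[OF c] eM by (auto simp: es'_def D'_def)
  have finR: "finite R" using matroidD(5)[OF mat coreD(4)[OF c]] .
  have R': "R' \<in> M" "R' \<subseteq> D'" "\<And>x. x \<in> D' \<Longrightarrow> insert x R' \<in> M \<Longrightarrow> x \<in> R'"
  proof -
    show "R' \<in> M" "R' \<subseteq> D'" using coreD(4,5)[OF c] by (auto simp: R'_def D'_def)
    show "x \<in> R'" if "x \<in> D'" "insert x R' \<in> M" for x
    proof -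
      have "insert x R \<in> M" by (rule matroidD(4)[OF mat that(2)]) (auto simp: R'_def)
      then show ?thesis using that coreD(6)[OF c, of x] by (auto simp: R'_def D'_def)
    qed
  qed
  have core': "core D' es' v' R' Y"
    if "Y \<in> lift_matroid l M" "fst ` Y \<subseteq> set es'" "\<And>x. x \<in> set es' \<Longrightarrow> a * f {x} \<le> 2 * g Y" for Y
    using that coreD(1)[OF c] eV set_es' v' R' by (auto simp: core_def D'_def)
  have single: "{(b, 0)} \<in> lift_matroid l M" "a * f {b} \<le> g {(b, 0)}" if "b \<in> set es'" for b
  proof -
    have "b \<in> V" using that set_es' coreD(1)[OF c] eV by (auto simp: D'_def)
    then show "a * f {b} \<le> g {(b, 0)}" using potential_singleton_ge[OF nms l] by (simp add: a_def)
    show "{(b, 0)} \<in> lift_matroid l M" using that set_es' l by (simp add: lift_matroid_def)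
  qed
  have f0: "0 \<le> f {x}" if "x \<in> set es'" for x
    using that set_es' coreD(1)[OF c] eV by (intro nmsD(1)[OF nms]) (auto simp: D'_def)
  show ?thesis
  proof (cases "card R' \<le> 1")
    case True
    have b: "?b \<in> set es'" "\<And>x. x \<in> set es' \<Longrightarrow> f {x} \<le> f {?b}"
      using best[OF ne, where v = v'] v' by auto
    have c': "core D' es' v' R' {(?b, 0)}"
    proof (rule core')
      fix x assume x: "x \<in> set es'"
      have "a * f {x} \<le> a * f {?b}" using b(2)[OF x] a_ge_1 by (intro mult_left_mono) auto
      also have "\<dots> \<le> 1 * g {(?b, 0)}" using single(2)[OF b(1)] by simp
      also have "\<dots> \<le> 2 * g {(?b, 0)}"
        using g_nonneg[OF single(1)[OF b(1)]] by (intro mult_right_mono) auto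
      finally show "a * f {x} \<le> 2 * g {(?b, 0)}" .
    qed (use single[OF b(1)] b(1) in auto)
    have "f T \<le> f {?b}" if T: "T \<in> M" "T \<subseteq> D'" for T
    proof (cases "T = {}")
      case False
      have "card T \<le> 1" using core_card_le[OF c' T] True by simp
      moreover have "0 < card T" using False matroidD(5)[OF mat T(1)] by (simp add: card_gt_0_iff)
      ultimately have "card T = 1" by simp
      then obtain t where "T = {t}" by (rule card_1_singletonE)
      then show ?thesis using b(2) T set_es' by simp
    next
      case True
      then show ?thesis using b(1) set_es' coreD(1)[OF c] eV
        by (auto intro!: nmsD(2)[OF nms] simp: D'_def)
    qed
    then have "settled D' es' v' R' {(?b, 0)}" using True by (simp add: settled_def)
    then show ?thesis using True c'
      by (intro exI[of _ "{(?b, 0)}"] exI[of _ "[]"]) (simp add: update_def runs_Return)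
  next
    case False
    let ?W = "set (alive l (card R') v' es')"
    have rR: "real (card R') = real (card R) + of_bool (insert e R \<in> M \<and> e \<notin> R)"
      using finR by (auto simp: R'_def insert_absorb)
    have XD: "fst ` X \<subseteq> D'" using coreD(2,8)[OF c] by (auto simp: D'_def)
    have Xes: "fst ` X \<subseteq> set es'" using coreD(8)[OF c] by (auto simp: es'_def)
    have R'k: "0 < card R'" "card R' \<le> k" "0 < k"
      using False card_le_k[OF R'(1)] by auto
    have Kle2: "improvement_factor l k \<le> 2" using improvement_factor_le_2[OF l R'k(3)] .
    have gX: "0 \<le> g X" using g_nonneg[OF coreD(7)[OF c]] .
    have keep: "core D' es' v' R' X" if "a * f {e} \<le> 2 * g X"
      by (rule core') (use that coreD(7,9)[OF c] Xes in \<open>auto simp: es'_def\<close>)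
    \<comment> \<open>\<open>pay\<close> makes every older element cover the unsuccessful scan by a
      lost level or by the growth of the rank; only the scan of \<open>e\<close> is charged
      anew.\<close>
    have finish: "\<exists>X' ps. runs f M (improve_all l es' v' R' Y) (solution (es', v', R', X'), (es', v', R', X')) ps \<and>
        core D' es' v' R' X' \<and> settled D' es' v' R' X' \<and> (\<forall>Q\<in>set ps. Q \<subseteq> D') \<and>
        real (length ps) + scan_cost * pending es' R' X' \<le>
          scan_cost * (of_bool (e \<in> ?W) + real k + levels e (g Y)) + scan_cost * pending es R X"
      if Y: "core D' es' v' R' Y" and pay: "\<And>x. x \<in> set es \<Longrightarrow>
          of_bool (x \<in> ?W) + levels x (g Y) \<le> levels x (g X) + of_bool (insert e R \<in> M \<and> e \<notin> R)" for Y
    proof -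
      from runs_improve_all[OF Y ne] obtain X' ps where
        ps: "runs f M (improve_all l es' v' R' Y) (solution (es', v', R', X'), (es', v', R', X')) ps"
          "core D' es' v' R' X'" "locally_optimal es' v' R' X'" "\<forall>Q\<in>set ps. Q \<subseteq> D'"
          "real (length ps) + scan_cost * (\<Sum>x\<leftarrow>es'. levels x (g X')) \<le>
            scan_cost * (\<Sum>x\<leftarrow>es'. of_bool (x \<in> ?W) + levels x (g Y))" by blast
      have "(\<Sum>x\<leftarrow>es. of_bool (x \<in> ?W) + levels x (g Y)) + (\<Sum>x\<leftarrow>es. real k - real (card R')) \<le> pending es R X"
        unfolding pending_def sum_list_addf[symmetric]
        by (intro sum_list_mono) (use pay rR in \<open>force simp: algebra_simps\<close>)
      then have "(\<Sum>x\<leftarrow>es'. of_bool (x \<in> ?W) + levels x (g Y)) + (\<Sum>x\<leftarrow>es'. real k - real (card R')) \<le>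
          (of_bool (e \<in> ?W) + real k + levels e (g Y)) + pending es R X"
        by (simp add: es'_def)
      from mult_left_mono[OF this scan_cost_nonneg] have
        "scan_cost * (\<Sum>x\<leftarrow>es'. of_bool (x \<in> ?W) + levels x (g Y)) + scan_cost * (\<Sum>x\<leftarrow>es'. real k - real (card R')) \<le>
          scan_cost * (of_bool (e \<in> ?W) + real k + levels e (g Y)) + scan_cost * pending es R X"
        by (simp only: distrib_left)
      moreover have "pending es' R' X' = (\<Sum>x\<leftarrow>es'. real k - real (card R')) + (\<Sum>x\<leftarrow>es'. levels x (g X'))"
        unfolding pending_def sum_list_addf ..
      ultimately have "real (length ps) + scan_cost * pending es' R' X' \<le>
          scan_cost * (of_bool (e \<in> ?W) + real k + levels e (g Y)) + scan_cost * pending es R X"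
        using ps(5) by (simp only: distrib_left)
      then show ?thesis using ps False
        by (intro exI[of _ X'] exI[of _ ps]) (simp add: settled_def)
    qed
    have drop: "of_bool (x \<in> ?W) + levels x (g Y) \<le> levels x (g X)"
      if Y: "core D' es' v' R' Y" "improvement_factor l k * g X \<le> g Y" "g X < g Y"
        and x: "x \<in> set es'" "a * f {x} \<le> 2 * g X" for x Y
    proof (cases "x \<in> ?W")
      case True
      from levels_decrease[OF Y(1) True x(2) core_g_le[OF Y(1) ne coreD(7,8)[OF Y(1)]] Y(2,3)] True
      show ?thesis by simp
    next
      case False
      then show ?thesis using levels_antimono[OF R'k(3) f0[OF x(1)] x(2)] Y(3) by simp
    qed
    let ?upd = "\<lambda>x. if 2 * x < a * v' e then improve_all l es' v' R' ?e0
        else if insert e R \<in> M \<and> e \<notin> R then improve_all l es' v' R' X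
        else search l (improvement_factor l (card R')) X (all_moves l X [e]) (\<lambda>res. case res of
            None \<Rightarrow> Return (solution (es', v', R', X), (es', v', R', X))
          | Some Z \<Rightarrow> improve_all l es' v' R' Z)"
    have upd: "update l es' v' R' (insert e R \<in> M \<and> e \<notin> R) X e = eval_potential l X ?upd"
      using False unfolding update_def a_def by simp
    have e: "e \<in> set es'" "e \<in> D'" by (simp_all add: es'_def D'_def)
    have old: "x \<in> set es' \<and> a * f {x} \<le> 2 * g X" if "x \<in> set es" for x
      using that coreD(9)[OF c] by (simp add: es'_def)
    have "\<exists>X' ps. runs f M (?upd (g X)) (solution (es', v', R', X'), (es', v', R', X')) ps \<and>
        core D' es' v' R' X' \<and> settled D' es' v' R' X' \<and> (\<forall>Q\<in>set ps. Q \<subseteq> D') \<and>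
        real (length ps) + scan_cost * pending es' R' X' \<le>
          scan_cost * (1 + real k + max_levels) + scan_cost * pending es R X"
    proof (cases "2 * g X < a * v' e")
      case True
      \<comment> \<open>Resetting more than doubles the potential, which exceeds every improvement
        factor, so each alive older element loses a level.\<close>
      have ge: "a * f {e} \<le> g ?e0" using single(2)[OF e(1)] .
      have gX0: "2 * g X < g ?e0" using True ge v'[OF e(1)] by simp
      have K: "improvement_factor l k * g X \<le> g ?e0"
        using mult_right_mono[OF Kle2 gX] gX0 by linarith
      have lt: "g X < g ?e0" using gX0 gX by linarith
      have c0: "core D' es' v' R' ?e0"
      proof (rule core')
        fix x assume "x \<in> set es'"
        then have "x = e \<or> a * f {x} \<le> 2 * g X" using coreD(9)[OF c] by (auto simp: es'_def)
        then show "a * f {x} \<le> 2 * g ?e0" using ge gX0 lt gX by auto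
      qed (use single[OF e(1)] e in auto)
      have "of_bool (x \<in> ?W) + levels x (g ?e0) \<le> levels x (g X) + of_bool (insert e R \<in> M \<and> e \<notin> R)"
        if "x \<in> set es" for x
        using drop[OF c0 K lt, of x] old[OF that] by (simp add: add_increasing2)
      from finish[OF c0 this] obtain X' ps where
        ps: "runs f M (improve_all l es' v' R' ?e0) (solution (es', v', R', X'), (es', v', R', X')) ps"
          "core D' es' v' R' X'" "settled D' es' v' R' X'" "\<forall>Q\<in>set ps. Q \<subseteq> D'"
          "real (length ps) + scan_cost * pending es' R' X' \<le>
            scan_cost * (of_bool (e \<in> ?W) + real k + levels e (g ?e0)) + scan_cost * pending es R X" by blast
      have "levels e (g ?e0) \<le> max_levels"
        by (rule levels_le_max_levels[OF R'k(3) f0[OF e(1)] coreD(9)[OF c0 e(1)]])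
      then have "scan_cost * (of_bool (e \<in> ?W) + real k + levels e (g ?e0)) \<le> scan_cost * (1 + real k + max_levels)"
        by (intro mult_left_mono scan_cost_nonneg) (auto simp: of_bool_def)
      then show ?thesis using ps True by (intro exI[of _ X'] exI[of _ ps]) auto
    next
      case noreset: False
      then have low: "a * f {e} \<le> 2 * g X" using v'[OF e(1)] by simp
      note cX = keep[OF low]
      have lev: "levels e (g X) \<le> max_levels"
        by (rule levels_le_max_levels[OF R'k(3) f0[OF e(1)] low])
      show ?thesis
      proof (cases "insert e R \<in> M \<and> e \<notin> R")
        case True
        \<comment> \<open>The potential is unchanged here; the growth of the rank pays.\<close>
        have "of_bool (x \<in> ?W) + levels x (g X) \<le> levels x (g X) + of_bool (insert e R \<in> M \<and> e \<notin> R)" for x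
          using True by simp
        from finish[OF cX this] obtain X' ps where
          ps: "runs f M (improve_all l es' v' R' X) (solution (es', v', R', X'), (es', v', R', X')) ps"
            "core D' es' v' R' X'" "settled D' es' v' R' X'" "\<forall>Q\<in>set ps. Q \<subseteq> D'"
            "real (length ps) + scan_cost * pending es' R' X' \<le>
              scan_cost * (of_bool (e \<in> ?W) + real k + levels e (g X)) + scan_cost * pending es R X" by blast
        have "scan_cost * (of_bool (e \<in> ?W) + real k + levels e (g X)) \<le> scan_cost * (1 + real k + max_levels)"
          using lev by (intro mult_left_mono scan_cost_nonneg) (auto simp: of_bool_def)
        then show ?thesis using ps noreset True by (intro exI[of _ X'] exI[of _ ps]) auto
      next
        case nogrow: False
        let ?\<kappa> = "improvement_factor l (card R')"
        let ?c = "\<lambda>res. case res of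
            None \<Rightarrow> Return (solution (es', v', R', X), (es', v', R', X))
          | Some Z \<Rightarrow> improve_all l es' v' R' Z"
        have RR: "R' = R" using nogrow by (auto simp: R'_def insert_absorb)
        have fin: "finite X" using lift_matroid_finite[OF mat coreD(7)[OF c]] .
        let ?Zs = "all_moves l X [e]"
        have Zs: "set ?Zs = moves l X e" using set_all_moves[OF fin, of l "[e]"] by simp
        have ZsD: "\<forall>Z\<in>set ?Zs. fst ` Z \<subseteq> D'"
          unfolding Zs by (intro ballI order_trans[OF fst_moves]) (use XD e(2) in auto)
        have cost: "real (length ?Zs * (1 + 2 * 2 ^ l)) \<le> scan_cost"
          using length_all_moves_le[OF coreD(7)[OF c], of "[e]"] by simp
        have upd': "?upd (g X) = search l ?\<kappa> X ?Zs ?c" using noreset nogrow by auto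
        show ?thesis
        proof (cases "find (\<lambda>Z. fst ` Z \<in> M \<and> ?\<kappa> * g X < g Z) ?Zs")
          case None
          have "runs f M (?c (find (\<lambda>Z. fst ` Z \<in> M \<and> ?\<kappa> * g X < g Z) ?Zs))
              (solution (es', v', R', X), (es', v', R', X)) []"
            unfolding None by (simp add: runs_Return)
          from runs_search[where k = ?c, OF this XD ZsD] obtain ps where
            ps: "runs f M (search l ?\<kappa> X ?Zs ?c) (solution (es', v', R', X), (es', v', R', X)) (ps @ [])"
              "length ps \<le> length ?Zs * (1 + 2 * 2 ^ l)" "\<forall>Q\<in>set ps. Q \<subseteq> D'" by blast
          have "locally_optimal es' v' R' X"
            unfolding locally_optimal_def
          proof (intro ballI impI)
            fix x Z assume h: "x \<in> ?W" "Z \<in> moves l X x" "fst ` Z \<in> M"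
            show "g Z \<le> ?\<kappa> * g X"
            proof (cases "x = e")
              case True
              then show ?thesis using None h unfolding find_None_iff Zs by force
            next
              case False
              \<comment> \<open>An older element that is alive now was alive before \<open>e\<close>
                arrived, the rank being the same, so the previous local optimality covers
                it.\<close>
              then have x: "x \<in> set es" using h(1) unfolding set_alive by (simp add: es'_def)
              have "v y \<le> real l * real (card R) * v x" if "y \<in> set es" for y
              proof -
                have "v' y \<le> real l * real (card R') * v' x"
                  using h(1) that unfolding set_alive by (simp add: es'_def)
                then show ?thesis
                  using v'[of y] v'[of x] coreD(3)[OF c x] coreD(3)[OF c that] x that RR by (simp add: es'_def)
              qed
              then have "x \<in> set (alive l (card R) v es)" unfolding set_alive using x by simp
              then show ?thesis
                using s h \<open>\<not> card R' \<le> 1\<close> RR unfolding settled_def locally_optimal_def by simp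
            qed
          qed
          then have "settled D' es' v' R' X" using \<open>\<not> card R' \<le> 1\<close> by (simp add: settled_def)
          moreover have "pending es' R' X = (real k - real (card R) + levels e (g X)) + pending es R X"
            by (simp add: pending_def es'_def RR)
          then have "scan_cost * pending es' R' X \<le> scan_cost * (real k + max_levels) + scan_cost * pending es R X"
            using lev unfolding distrib_left[symmetric] by (intro mult_left_mono scan_cost_nonneg) simp
          moreover have "real (length ps) \<le> scan_cost"
            using cost ps(2) by (meson of_nat_le_iff order_trans)
          ultimately show ?thesis using ps cX unfolding upd'
            by (intro exI[of _ X] exI[of _ ps]) (simp add: distrib_left)
        next
          case (Some Z)
          then have "Z \<in> set ?Zs" and Z': "fst ` Z \<in> M" "?\<kappa> * g X < g Z"
            by (auto simp: find_Some_iff in_set_conv_nth)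
          then have Z: "Z \<in> moves l X e" "fst ` Z \<in> M" "?\<kappa> * g X < g Z" unfolding Zs by simp_all
          have \<kappa>: "1 < ?\<kappa>" "improvement_factor l k \<le> ?\<kappa>"
            using improvement_factor_gt_1[OF l R'k(1)] improvement_factor_antimono[OF l R'k(1,2)] by simp_all
          have gXZ: "g X < g Z" using Z(3) \<kappa>(1) gX mult_right_mono[of 1 ?\<kappa> "g X"] by simp
          have KZ: "improvement_factor l k * g X \<le> g Z" using mult_right_mono[OF \<kappa>(2) gX] Z(3) by linarith
          have cZ: "core D' es' v' R' Z" using core_move[OF cX Z(1) e(1) Z(2)] gXZ by simp
          have "of_bool (x \<in> ?W) + levels x (g Z) \<le> levels x (g X) + of_bool (insert e R \<in> M \<and> e \<notin> R)"
            if "x \<in> set es" for x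
            using drop[OF cZ KZ gXZ, of x] old[OF that] nogrow by simp
          from finish[OF cZ this] obtain X' ps2 where
            ps2: "runs f M (improve_all l es' v' R' Z) (solution (es', v', R', X'), (es', v', R', X')) ps2"
              "core D' es' v' R' X'" "settled D' es' v' R' X'" "\<forall>Q\<in>set ps2. Q \<subseteq> D'"
              "real (length ps2) + scan_cost * pending es' R' X' \<le>
                scan_cost * (of_bool (e \<in> ?W) + real k + levels e (g Z)) + scan_cost * pending es R X" by blast
          have "runs f M (?c (find (\<lambda>Z. fst ` Z \<in> M \<and> ?\<kappa> * g X < g Z) ?Zs))
              (solution (es', v', R', X'), (es', v', R', X')) ps2"
            unfolding Some using ps2(1) by simp
          from runs_search[where k = ?c, OF this XD ZsD] obtain ps where
            ps: "runs f M (search l ?\<kappa> X ?Zs ?c) (solution (es', v', R', X'), (es', v', R', X')) (ps @ ps2)"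
              "length ps \<le> length ?Zs * (1 + 2 * 2 ^ l)" "\<forall>Q\<in>set ps. Q \<subseteq> D'" by blast
          \<comment> \<open>A rescan of \<open>e\<close> is paid for by a level of its own, which
            leaves one unit for the search.\<close>
          have "scan_cost * (of_bool (e \<in> ?W) + real k + levels e (g Z)) \<le> scan_cost * (real k + max_levels)"
            using drop[OF cZ KZ gXZ e(1) low] lev by (intro mult_left_mono scan_cost_nonneg) simp
          moreover have "real (length ps) \<le> scan_cost"
            using cost ps(2) by (meson of_nat_le_iff order_trans)
          ultimately have "real (length (ps @ ps2)) + scan_cost * pending es' R' X' \<le>
              scan_cost * (1 + real k + max_levels) + scan_cost * pending es R X"
            using ps2(5) by (simp add: distrib_left)
          moreover have "\<forall>Q\<in>set (ps @ ps2). Q \<subseteq> D'" using ps(3) ps2(4) by auto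
          ultimately show ?thesis using ps(1) ps2(2,3) unfolding upd'
            by (intro exI[of _ X'] exI[of _ "ps @ ps2"] conjI)
        qed
      qed
    qed
    then obtain X' ps where
      ps: "runs f M (?upd (g X)) (solution (es', v', R', X'), (es', v', R', X')) ps"
        "core D' es' v' R' X'" "settled D' es' v' R' X'" "\<forall>Q\<in>set ps. Q \<subseteq> D'"
        "real (length ps) + scan_cost * pending es' R' X' \<le>
          scan_cost * (1 + real k + max_levels) + scan_cost * pending es R X" by blast
    from runs_eval_potential[where k = ?upd, OF ps(1) XD] obtain qs where
      qs: "runs f M (eval_potential l X ?upd) (solution (es', v', R', X'), (es', v', R', X')) (qs @ ps)"
        "length qs = 2 ^ l" "\<forall>Q\<in>set qs. Q \<subseteq> D'" by blast
    have "real (length (qs @ ps)) + scan_cost * pending es' R' X' \<le>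
          2 ^ l + scan_cost * (1 + real k + max_levels) + scan_cost * pending es R X"
      using ps(5) qs(2) by simp
    moreover have "\<forall>Q\<in>set (qs @ ps). Q \<subseteq> D'" using qs(3) ps(4) by auto
    ultimately show ?thesis using qs(1) ps(2,3) False unfolding upd by blast
  qed
qed

section \<open>The invariant over the stream\<close>

text \<open>The 3 stands for the queries that \<open>step\<close> makes before
  \<open>update\<close>.\<close>

definition budget :: real where
  "budget = 3 + 2 ^ l + scan_cost * (1 + real k + max_levels)"

text \<open>Of the two bounds on \<open>c\<close>, the first is free of \<open>l\<close> and serves
  matroids of rank at most 1; the second includes the unspent credit.\<close>

definition invariant :: "'a list \<Rightarrow> 'a state \<Rightarrow> nat \<Rightarrow> bool" where
  "invariant xs s c \<longleftrightarrow> (case s of (es, v, R, X) \<Rightarrow>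
     core (set xs) es v R X \<and> settled (set xs) es v R X \<and> length es \<le> length xs \<and>
     (card R \<le> 1 \<longrightarrow> c \<le> 3 * length xs) \<and>
     real c + scan_cost * pending es R X \<le> real (length xs) * budget)"

lemma budget_ge_3: "3 \<le> budget"
  using scan_cost_nonneg max_levels_nonneg by (simp add: budget_def)

lemma pending_nonneg:
  assumes "core D es v R X"
  shows "0 \<le> pending es R X"
  unfolding pending_def
  using levels_nonneg card_le_k[OF coreD(4)[OF assms]] by (intro sum_list_nonneg) (auto intro!: add_nonneg_nonneg)

lemma pending_le:
  assumes c: "core D es v R X"
  shows "pending es R X \<le> real (length es) * (real k + max_levels)"
proof -
  have "pending es R X \<le> (\<Sum>e\<leftarrow>es. real k + max_levels)"
    unfolding pending_def
  proof (rule sum_list_mono)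
    fix e assume e: "e \<in> set es"
    then have "es \<noteq> []" by auto
    from levels_le_max_levels[OF core_rank_pos(3)[OF c this] core_value_nonneg[OF c e] coreD(9)[OF c e]]
    show "real k - real (card R) + levels e (g X) \<le> real k + max_levels" by simp
  qed
  then show ?thesis by (simp add: sum_list_triv)
qed

text \<open>While the rank is at most 1, the credit is not tracked from round to round. Every
  element is granted the largest possible credit, which the budget affords because at most three
  queries per round have been made.\<close>

lemma rank_le_1_cost:
  assumes "core D es v R X" "length es \<le> n" "c \<le> 3 * n"
  shows "real c + scan_cost * pending es R X \<le> real n * budget"
proof -
  have "pending es R X \<le> real (length es) * (real k + max_levels)" by (rule pending_le[OF assms(1)])
  also have "\<dots> \<le> real n * (1 + real k + max_levels)"
    using assms(2) max_levels_nonneg by (intro mult_mono) auto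
  finally have "scan_cost * pending es R X \<le> scan_cost * (real n * (1 + real k + max_levels))"
    by (intro mult_left_mono scan_cost_nonneg)
  moreover have "real c \<le> real n * (3 + 2 ^ l)" using assms(3) by (simp add: distrib_left add_increasing2)
  ultimately show ?thesis by (simp add: budget_def algebra_simps)
qed

lemma invariant_step:
  assumes inv: "invariant xs s c" and V: "set (xs @ [e]) \<subseteq> V"
  shows "\<exists>s' qs. runs f M (step l s e) (solution s', s') qs \<and> invariant (xs @ [e]) s' (c + length qs) \<and>
           (\<forall>Q\<in>set qs. Q \<subseteq> set (xs @ [e]))"
proof -
  obtain es v R X where s: "s = (es, v, R, X)" by (cases s) auto
  have c: "core (set xs) es v R X" and st: "settled (set xs) es v R X" and len: "length es \<le> length xs"
    and c1: "card R \<le> 1 \<Longrightarrow> c \<le> 3 * length xs"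
    and cost: "real c + scan_cost * pending es R X \<le> real (length xs) * budget"
    using inv by (auto simp: invariant_def s)
  have D': "set (xs @ [e]) = insert e (set xs)" by simp
  have lb: "real (length (xs @ [e])) * budget = real (length xs) * budget + budget"
    by (simp add: algebra_simps)
  show ?thesis
  proof (cases "{e} \<in> M")
    case False
    have no: "e \<notin> T" if "T \<in> M" for T using matroidD(4)[OF mat that, of "{e}"] False by auto
    have "insert e R \<notin> M" using no by blast
    then have "core (insert e (set xs)) es v R X"
      unfolding core_def using coreD[OF c] no V False by auto
    moreover have "settled (insert e (set xs)) es v R X"
      using st no unfolding settled_def by (auto split: if_splits)
    ultimately have "invariant (xs @ [e]) s (c + length [{e}])"
      unfolding invariant_def s D' lb using len c1 cost budget_ge_3 by auto
    moreover have "runs f M (step l s e) (solution s, s) [{e}]"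
      unfolding s using False by (simp add: runs_Query_Member runs_Return)
    ultimately show ?thesis by (intro exI[of _ s] exI[of _ "[{e}]"]) auto
  next
    case True
    let ?R = "if insert e R \<in> M then insert e R else R"
    have "e \<in> V" using V by simp
    from runs_update[OF c st this True] obtain X' qs where
      X': "runs f M (update l (e # es) (v(e := f {e})) ?R (insert e R \<in> M \<and> e \<notin> R) X e)
          (solution (e # es, v(e := f {e}), ?R, X'), (e # es, v(e := f {e}), ?R, X')) qs"
        "core (insert e (set xs)) (e # es) (v(e := f {e})) ?R X'"
        "settled (insert e (set xs)) (e # es) (v(e := f {e})) ?R X'"
        "\<forall>Q\<in>set qs. Q \<subseteq> insert e (set xs)" "card ?R \<le> 1 \<Longrightarrow> qs = []"
        "1 < card ?R \<Longrightarrow> real (length qs) + scan_cost * pending (e # es) ?R X' \<le>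
          2 ^ l + scan_cost * (1 + real k + max_levels) + scan_cost * pending es R X" by blast
    let ?s = "(e # es, v(e := f {e}), ?R, X')" and ?qs = "{e} # {e} # insert e R # qs"
    have "card R \<le> card ?R"
      using matroidD(5)[OF mat coreD(4)[OF c]] by (auto intro: card_mono)
    then have 1: "c + length ?qs \<le> 3 * length (xs @ [e])" if "card ?R \<le> 1"
      using c1 X'(5)[OF that] that by simp
    have "real (c + length ?qs) + scan_cost * pending (e # es) ?R X' \<le> real (length (xs @ [e])) * budget"
    proof (cases "card ?R \<le> 1")
      case True
      show ?thesis by (rule rank_le_1_cost[OF X'(2) _ 1[OF True]]) (use len in simp)
    next
      case False
      then have "1 < card ?R" by simp
      from X'(6)[OF this] cost show ?thesis unfolding lb by (simp add: budget_def)
    qed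
    then have "invariant (xs @ [e]) ?s (c + length ?qs)"
      unfolding invariant_def D' using X'(2,3) 1 len by simp
    moreover have "runs f M (step l s e) (solution ?s, ?s) ?qs"
      unfolding s step.simps using True X'(1)
      by (auto intro!: runs_Query_Member runs_Query_Value)
    moreover have "\<forall>Q\<in>set ?qs. Q \<subseteq> set (xs @ [e])" using X'(4) coreD(5)[OF c] by auto
    ultimately show ?thesis by blast
  qed
qed

lemma invariant_initial: "invariant [] ([], v, {}, {}) 0"
  using matroidD(2)[OF mat]
  by (auto simp: invariant_def core_def settled_def pending_def lift_matroid_def)

lemma invariant_good_round:
  assumes inv: "invariant xs s c"
  shows "good_round (1 - 1 / exp 1 - 3 / real l) f M (set xs) (solution s)"
proof -
  obtain es v R X where s: "s = (es, v, R, X)" by (cases s) auto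
  have c: "core (set xs) es v R X" and st: "settled (set xs) es v R X"
    using inv by (auto simp: invariant_def s)
  let ?F = "{T \<in> M. T \<subseteq> set xs}"
  have fin: "finite ?F" by (rule finite_subset[of _ "Pow (set xs)"]) auto
  have "opt f M (set xs) \<in> f ` ?F"
    unfolding opt_def using fin matroidD(2)[OF mat] by (intro Max_in) auto
  then obtain T where T: "T \<in> M" "T \<subseteq> set xs" "opt f M (set xs) = f T" by auto
  have "f T' \<le> f T" if "T' \<in> M" "T' \<subseteq> set xs" for T'
    unfolding T(3)[symmetric] opt_def using fin that by (intro Max_ge) auto
  from settled_value[OF c st T(1,2) this] show ?thesis
    using coreD(2,7,8)[OF c] T(3) by (auto simp: good_round_def solution_def s lift_matroid_def)
qed

lemma invariant_cost:
  assumes "invariant xs s c"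
  shows "real c \<le> real (length xs) * budget" "k \<le> 1 \<Longrightarrow> c \<le> 3 * length xs"
proof -
  obtain es v R X where s: "s = (es, v, R, X)" by (cases s) auto
  have c: "core (set xs) es v R X" using assms by (auto simp: invariant_def s)
  have "0 \<le> scan_cost * pending es R X" using scan_cost_nonneg pending_nonneg[OF c] by simp
  then show "real c \<le> real (length xs) * budget" using assms by (auto simp: invariant_def s)
  show "c \<le> 3 * length xs" if "k \<le> 1"
    using assms card_le_k[OF coreD(4)[OF c]] that by (auto simp: invariant_def s)
qed

section \<open>Bounding the budget by a power of the rank\<close>

text \<open>Crude bounds suffice, as only the exponent of \<open>k\<close> counts in the end: ln z
  \<le> z, and ln (1 + \<delta>) \<ge> \<delta>/2 for \<delta> \<le> 1.\<close>

lemma max_levels_le: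
  assumes "0 < k"
  shows "max_levels \<le> 4 * real l ^ 5 * real k ^ 3"
proof -
  let ?\<delta> = "1 / ((real l)\<^sup>2 * real k)" and ?z = "2 * real l ^ 3 * (real k)\<^sup>2"
  have p: "0 < (real l)\<^sup>2 * real k" using l assms by simp
  have K: "improvement_factor l k = 1 + ?\<delta>" "1 < improvement_factor l k"
    using improvement_factor_gt_1[OF l assms] by (simp_all add: improvement_factor_def)
  have "1 - 1 / (1 + ?\<delta>) \<le> ln (1 + ?\<delta>)"
    using ln_le_minus_one[of "1 / (1 + ?\<delta>)"] ln_div[of 1 "1 + ?\<delta>"] K by simp
  moreover have "?\<delta> / 2 \<le> 1 - 1 / (1 + ?\<delta>)"
  proof -
    have "d / 2 \<le> 1 - 1 / (1 + d)" if "0 < d" "d \<le> 1" for d :: real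
    proof -
      have "d / 2 \<le> d / (1 + d)" using that by (intro divide_left_mono) auto
      also have "\<dots> = 1 - 1 / (1 + d)" using that by (simp add: field_simps)
      finally show ?thesis .
    qed
    moreover have "0 < ?\<delta>" "?\<delta> \<le> 1" using improvement_factor_le_2[OF l assms] K by simp_all
    ultimately show ?thesis by blast
  qed
  ultimately have "?\<delta> / 2 \<le> ln (1 + ?\<delta>)" by linarith
  then have "?\<delta> / 2 \<le> ln (improvement_factor l k)" unfolding K(1) .
  moreover have "ln ?z \<le> ?z" using ln_le_minus_one[of ?z] l assms by simp
  moreover have "0 < ?\<delta> / 2" using p by simp
  ultimately have "max_levels \<le> ?z / (?\<delta> / 2)"
    unfolding max_levels_def log_def using p by (intro frac_le) auto
  also have "\<dots> = 4 * real l ^ 5 * real k ^ 3"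
    using p by (simp add: field_simps power2_eq_square eval_nat_numeral)
  finally show ?thesis .
qed

text \<open>For k \<ge> 2 powers of \<open>k\<close> absorb everything: \<open>2 ^ l\<close> and
  \<open>l\<close> are at most \<open>k ^ l\<close>, and doubling raises the exponent by one.
  Scanning an element accounts for 2 l + 4 in the exponent, the number of scans for 5 l + 6, and the
  last sum for 1.\<close>

lemma budget_le:
  assumes k2: "2 \<le> k"
  shows "budget \<le> real k ^ (7 * l + 11)"
proof -
  let ?k = "real k"
  have k: "2 \<le> ?k" "1 \<le> ?k" using k2 by simp_all
  have mono: "?k ^ i \<le> ?k ^ j" if "i \<le> j" for i j using k(2) that by (rule power_increasing[rotated])
  have two: "2 ^ i \<le> ?k ^ i" for i using k(1) by (intro power_mono) auto
  have dbl: "2 * ?k ^ i \<le> ?k ^ Suc i" for i using k by (simp add: mult_right_mono)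
  have lk: "real l \<le> ?k ^ l"
    using two[of l] of_nat_less_two_power[of l, where 'a = real] by linarith
  have "1 + ?k + max_levels \<le> ?k ^ (5 * l + 6)"
  proof -
    have "real l ^ 5 \<le> ?k ^ (5 * l)"
      using power_mono[OF lk, of 5] by (simp add: power_mult[symmetric] mult.commute)
    then have "4 * real l ^ 5 * ?k ^ 3 \<le> ?k ^ 2 * ?k ^ (5 * l) * ?k ^ 3"
      using two[of 2] k by (intro mult_mono) auto
    also have "\<dots> = ?k ^ (5 * l + 5)" by (simp add: power_add eval_nat_numeral mult_ac)
    finally have 1: "max_levels \<le> ?k ^ (5 * l + 5)" using max_levels_le k2 by simp
    have "1 + ?k \<le> 2 * ?k ^ 1" using k by simp
    also have "\<dots> \<le> ?k ^ Suc 1" by (rule dbl)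
    also have "\<dots> \<le> ?k ^ (5 * l + 5)" by (rule mono) simp
    finally have "1 + ?k + max_levels \<le> 2 * ?k ^ (5 * l + 5)" using 1 by simp
    also have "\<dots> \<le> ?k ^ Suc (5 * l + 5)" by (rule dbl)
    finally show ?thesis by (simp add: eval_nat_numeral)
  qed
  moreover have "scan_cost \<le> ?k ^ (2 * l + 4)"
  proof -
    have "?k + 1 \<le> 2 * ?k ^ 1" using k by simp
    also have "\<dots> \<le> ?k ^ 2" using dbl[of 1] unfolding Suc_1 .
    finally have "?k + 1 \<le> ?k ^ 2" .
    moreover have "1 + 2 * 2 ^ l \<le> ?k ^ (l + 2)"
    proof -
      have "(1::real) \<le> 2 ^ l" "(2::real) ^ (l + 2) = 4 * 2 ^ l" by (simp_all add: power_add)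
      then have "1 + 2 * 2 ^ l \<le> (2::real) ^ (l + 2)" by linarith
      then show ?thesis using two[of "l + 2"] by linarith
    qed
    ultimately have "scan_cost \<le> ?k ^ l * ?k ^ 2 * ?k ^ (l + 2)"
      unfolding scan_cost_def using lk k by (intro mult_mono) auto
    also have "\<dots> = ?k ^ (l + 2 + (l + 2))" by (simp only: power_add)
    also have "l + 2 + (l + 2) = 2 * l + 4" by simp
    finally show ?thesis .
  qed
  ultimately have "scan_cost * (1 + ?k + max_levels) \<le> ?k ^ (2 * l + 4) * ?k ^ (5 * l + 6)"
    using max_levels_nonneg by (intro mult_mono) auto
  also have "\<dots> = ?k ^ (7 * l + 10)" by (simp add: power_add[symmetric])
  finally have 1: "scan_cost * (1 + ?k + max_levels) \<le> ?k ^ (7 * l + 10)" .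
  have "(1::real) \<le> 2 ^ l" "(2::real) ^ (l + 2) = 4 * 2 ^ l" by (simp_all add: power_add)
  then have "3 + 2 ^ l \<le> (2::real) ^ (l + 2)" by linarith
  also have "\<dots> \<le> ?k ^ (l + 2)" by (rule two)
  also have "\<dots> \<le> ?k ^ (7 * l + 10)" by (rule mono) simp
  finally have "budget \<le> 2 * ?k ^ (7 * l + 10)" using 1 by (simp add: budget_def)
  also have "\<dots> \<le> ?k ^ Suc (7 * l + 10)" by (rule dbl)
  finally show ?thesis by (simp add: eval_nat_numeral)
qed

lemma run_from_empty:
  assumes "set es \<subseteq> V"
  shows "\<exists>rs. run f M (local_search l ([], v, {}, {})) es = return_pmf rs \<and>
    (\<forall>i<length es. good_round (1 - 1 / exp 1 - 3 / real l) f M (inserted es i) (fst (rs ! i)) \<and>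
       (\<forall>Q\<in>set (snd (rs ! i)). Q \<subseteq> inserted es i)) \<and>
    real (total_queries rs) \<le> real (length es) * (3 * real (max 1 k) ^ (7 * l + 11))"
  supply split_paired_Ex [simp del]
proof -
  from run_local_search[of invariant V f M l, OF invariant_step invariant_initial, of es v] assms
  obtain rs where rs: "run f M (local_search l ([], v, {}, {})) es = return_pmf rs"
    "\<forall>i<length es. (\<exists>s' c'. fst (rs ! i) = solution s' \<and> invariant (take (Suc i) es) s' c') \<and>
       (\<forall>Q\<in>set (snd (rs ! i)). Q \<subseteq> set (take (Suc i) es))"
    "\<exists>s'. invariant es s' (total_queries rs)" by auto
  have "real (total_queries rs) \<le> real (length es) * (3 * real (max 1 k) ^ (7 * l + 11))"
  proof (cases "k \<le> 1")
    case True
    then show ?thesis using rs(3) invariant_cost(2) by fastforce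
  next
    case False
    have "real (total_queries rs) \<le> real (length es) * budget" using rs(3) invariant_cost(1) by blast
    also have "budget \<le> 3 * real (max 1 k) ^ (7 * l + 11)"
    proof -
      have "budget \<le> real k ^ (7 * l + 11)" using budget_le False by simp
      moreover have "0 \<le> real k ^ (7 * l + 11)" by simp
      ultimately have "budget \<le> 3 * real k ^ (7 * l + 11)" by linarith
      then show ?thesis using False by (simp add: max_def)
    qed
    finally show ?thesis by (simp add: mult_left_mono)
  qed
  moreover have "good_round (1 - 1 / exp 1 - 3 / real l) f M (inserted es i) (fst (rs ! i)) \<and>
       (\<forall>Q\<in>set (snd (rs ! i)). Q \<subseteq> inserted es i)" if "i < length es" for i
    using rs(2) that invariant_good_round unfolding inserted_def by metis
  ultimately show ?thesis using rs(1) by blast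
qed

end

section \<open>Assembling the theorem\<close>

lemma good_round_antimono:
  assumes "nonneg_monotone_submodular V f" "matroid V M" "finite W" "\<gamma>' \<le> \<gamma>" "good_round \<gamma> f M W S"
  shows "good_round \<gamma>' f M W S"
proof -
  have "finite {T \<in> M. T \<subseteq> W}" by (rule finite_subset[of _ "Pow W"]) (use assms(3) in auto)
  then have "f {} \<le> opt f M W" unfolding opt_def using matroidD(2)[OF assms(2)] by (intro Max_ge) auto
  moreover have "0 \<le> f {}" using nmsD(1)[OF assms(1)] by simp
  ultimately have "\<gamma>' * opt f M W \<le> \<gamma> * opt f M W" using assms(4) by (intro mult_right_mono) auto
  then show ?thesis using assms(5) by (auto simp: good_round_def)
qed

theorem theorem1p4:
  shows "\<exists>(C::real) (g::real \<Rightarrow> real).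
    g \<in> soft_bigo (at_right 0) (\<lambda>\<epsilon>. 1 / \<epsilon>\<^sup>2) \<and>
    (\<forall>\<epsilon>>0. \<exists>A :: 'a algorithm.
       queries_only_inserted A \<and>
       approximation_guarantee A (1 - 1 / exp 1 - \<epsilon>) \<and>
       amortized_query_complexity A
         (\<lambda>k n. C * real (max 1 k) powr g \<epsilon> * ln (real (max 2 n))))"
proof -
  \<comment> \<open>Chosen so that the total loss 3/l is at most \<epsilon>.\<close>
  define l where "l \<epsilon> = nat \<lceil>3 / \<epsilon>\<rceil>" for \<epsilon> :: real
  define h where "h \<epsilon> = real (7 * l \<epsilon> + 11)" for \<epsilon>
  \<comment> \<open>The exponent is in fact linear in 1/\<epsilon>; it is compared with the square
    for \<epsilon> < 1.\<close>
  have "h \<in> O[at_right 0](\<lambda>\<epsilon>. 1 / \<epsilon>\<^sup>2)"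
  proof (rule bigoI)
    have "norm (h \<epsilon>) \<le> 39 * norm (1 / \<epsilon>\<^sup>2)" if \<epsilon>: "0 < \<epsilon>" "\<epsilon> < 1" for \<epsilon>
    proof -
      have "real (l \<epsilon>) \<le> 3 / \<epsilon> + 1" using \<epsilon> by (simp add: l_def)
      then have "h \<epsilon> \<le> 21 / \<epsilon> + 18" by (simp add: h_def)
      also have "\<dots> \<le> 39 / \<epsilon>\<^sup>2"
      proof -
        have "\<epsilon>\<^sup>2 \<le> \<epsilon>" "\<epsilon>\<^sup>2 \<le> 1" using \<epsilon> by (simp_all add: power2_eq_square mult_le_one)
        then have "21 / \<epsilon> \<le> 21 / \<epsilon>\<^sup>2" "18 / 1 \<le> 18 / \<epsilon>\<^sup>2" using \<epsilon> by (intro frac_le; simp)+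
        then show ?thesis by simp
      qed
      finally show ?thesis by (simp add: h_def)
    qed
    then show "\<forall>\<^sub>F \<epsilon> in at_right 0. norm (h \<epsilon>) \<le> 39 * norm (1 / \<epsilon>\<^sup>2)"
      by (intro eventually_mono[OF eventually_at_right_less[of 0]]
          eventually_mono[OF eventually_conj[OF eventually_at_right_less[of 0] eventually_at_right_real[of 0 1]]]) auto
  qed
  then have "h \<in> soft_bigo (at_right 0) (\<lambda>\<epsilon>. 1 / \<epsilon>\<^sup>2)"
    unfolding soft_bigo_def by (intro UN_I[of 0]) auto
  moreover have "\<exists>A :: 'a algorithm. queries_only_inserted A \<and>
       approximation_guarantee A (1 - 1 / exp 1 - \<epsilon>) \<and>
       amortized_query_complexity A (\<lambda>k n. 6 * real (max 1 k) powr h \<epsilon> * ln (real (max 2 n)))"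
    if \<epsilon>: "0 < \<epsilon>" for \<epsilon>
  proof -
    let ?l = "l \<epsilon>"
    have l: "0 < ?l" "3 / real ?l \<le> \<epsilon>"
    proof -
      have "0 < 3 / \<epsilon>" using \<epsilon> by simp
      then show "0 < ?l" by (simp add: l_def)
      have "3 / \<epsilon> \<le> real ?l" unfolding l_def by (rule real_nat_ceiling_ge)
      then show "3 / real ?l \<le> \<epsilon>" using \<epsilon> \<open>0 < ?l\<close> by (simp add: field_simps)
    qed
    define A :: "'a algorithm" where "A = local_search ?l ([], \<lambda>_. 0, {}, {})"
    have run: "\<exists>rs. run f M A es = return_pmf rs \<and>
        (\<forall>i<length es. good_round (1 - 1 / exp 1 - 3 / real ?l) f M (inserted es i) (fst (rs ! i)) \<and>
           (\<forall>Q\<in>set (snd (rs ! i)). Q \<subseteq> inserted es i)) \<and>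
        real (total_queries rs) \<le> real (length es) * (3 * real (max 1 (matroid_rank M)) ^ (7 * ?l + 11))"
      if "admissible V M f es" for V M f es
    proof -
      interpret local_search_instance V M f ?l
        by (rule local_search_instance.intro) (use that l(1) in \<open>simp_all add: admissible_def\<close>)
      show ?thesis
        using run_from_empty[of es "\<lambda>_. 0"] that unfolding A_def k_def by (simp add: admissible_def)
    qed
    have "queries_only_inserted A"
      unfolding queries_only_inserted_def
    proof (intro allI impI)
      fix V :: "'a set" and M f es assume "admissible V M f es"
      from run[OF this] obtain rs where rs: "run f M A es = return_pmf rs"
        "\<forall>i<length es. \<forall>Q\<in>set (snd (rs ! i)). Q \<subseteq> inserted es i" by blast
      show "\<forall>rs\<in>set_pmf (run f M A es). \<forall>i<length es. \<forall>Q\<in>set (snd (rs ! i)). Q \<subseteq> inserted es i"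
        using rs(2) unfolding rs(1) by simp
    qed
    moreover have "approximation_guarantee A (1 - 1 / exp 1 - \<epsilon>)"
      unfolding approximation_guarantee_def
    proof (intro allI impI)
      fix V :: "'a set" and M f es assume adm: "admissible V M f es"
      from run[OF this] obtain rs where rs: "run f M A es = return_pmf rs"
        "\<forall>i<length es. good_round (1 - 1 / exp 1 - 3 / real ?l) f M (inserted es i) (fst (rs ! i))" by blast
      have "good_round (1 - 1 / exp 1 - \<epsilon>) f M (inserted es i) (fst (rs ! i))" if "i < length es" for i
        by (rule good_round_antimono[where V = V, OF _ _ _ _ rs(2)[rule_format, OF that]])
          (use adm l(2) in \<open>auto simp: admissible_def inserted_def\<close>)
      then show "2 / 3 \<le> measure_pmf.prob (run f M A es)
          {rs. \<forall>i<length es. good_round (1 - 1 / exp 1 - \<epsilon>) f M (inserted es i) (fst (rs ! i))}"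
        unfolding rs(1) by simp
    qed
    moreover have "amortized_query_complexity A (\<lambda>k n. 6 * real (max 1 k) powr h \<epsilon> * ln (real (max 2 n)))"
      unfolding amortized_query_complexity_def
    proof (intro allI impI ballI)
      fix V :: "'a set" and M f es rs assume adm: "admissible V M f es" and "rs \<in> set_pmf (run f M A es)"
      let ?m = "real (max 1 (matroid_rank M))" and ?n = "length es"
      have "real (total_queries rs) \<le> real ?n * (3 * ?m ^ (7 * ?l + 11))"
        using run[OF adm] \<open>rs \<in> _\<close> by auto
      also have "?m ^ (7 * ?l + 11) = ?m powr h \<epsilon>" unfolding h_def by (rule powr_realpow[symmetric]) simp
      also have "3 * ?m powr h \<epsilon> \<le> 6 * ?m powr h \<epsilon> * ln (real (max 2 ?n))"
      proof -
        \<comment> \<open>The bound just obtained is independent of \<open>n\<close>. The logarithm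
          enters by being at least 1/2, which turns the factor 3 into 6.\<close>
        have "1 / 2 \<le> ln (2::real)" using ln_le_minus_one[of "1 / 2 :: real"] by (simp add: ln_div)
        also have "\<dots> \<le> ln (real (max 2 ?n))" by simp
        finally have "6 * ?m powr h \<epsilon> * (1 / 2) \<le> 6 * ?m powr h \<epsilon> * ln (real (max 2 ?n))"
          by (intro mult_left_mono) auto
        then show ?thesis by simp
      qed
      finally show "real (total_queries rs) \<le> real ?n * (6 * ?m powr h \<epsilon> * ln (real (max 2 ?n)))"
        by (simp add: mult_left_mono)
    qed
    ultimately show ?thesis by blast
  qed
  ultimately show ?thesis by blast
qed

end
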